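(* Let $G$ be a simple graph with vertex set $[\ell]=\{1,\dots,\ell\}$, let $\mathcal{A}=\mathcal{A}_G$ be the graphic arrangement of $G$ in $\mathbb{K}^\ell$, and let $H=H_{x_i-x_j}=\{x_i=x_j\}\in\mathcal{A}$, where $\{i,j\}\in E(G)$. Let $W$ be the set of vertices which are adjacent to both $i$ and $j$ in $G$, and for $k\in W$ let $y_k=x_k-x_i$ (regarded as an element of $S/(x_i-x_j)$). Then $$J_{\mathcal{A}}^H=\bigcap_{\{u,v\}\subset W,\ \{u,v\}\notin E(G)}(y_u,y_v),$$ where the intersection is over two-element subsets $\{u,v\}$ of $W$.
   Context: Let $\mathbb{K}$ be a field, $V=\mathbb{K}^\ell$ and $S=\mathbb{K}[x_1,\dots,x_\ell]$, where $x_1,\dots,x_\ell$ are the coordinate functions. For a simple graph $G$ with vertex set $[\ell]$ and edge set $E(G)$, the graphic arrangement is $\mathcal{A}_G=\{\{x_u=x_v\}\mid\{u,v\}\in E(G)\}$, a finite set of linear hyperplanes in $V$. For a finite set $\mathcal{A}$ of linear hyperplanes in $V$, $\alpha_H\in V^*$ denotes a defining linear form of $H\in\mathcal{A}$, and $Q(\mathcal{A})=\prod_{H\in\mathcal{A}}\alpha_H$. Let $\Omega_V^1=\bigoplus_i S\,dx_i$, $\Omega_V^2=\bigwedge^2\Omega_V^1$, and for $\alpha=\sum c_ix_i$ let $d\alpha=\sum c_i\,dx_i$. Define $$\Omega^1(\mathcal{A})=\{\omega\in \tfrac{1}{Q(\mathcal{A})}\Omega^1_V \mid Q(\mathcal{A})\,\omega\wedge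 d\alpha_L\in\alpha_L\Omega_V^2\ \text{for all } L\in\mathcal{A}\}.$$ For $H\in\mathcal{A}$, let $\overline S=S/(\alpha_H)=\mathrm{Sym}(H^* )$, let $\overline g$ denote the image in $\overline S$ of $g\in S$, and let $\mathcal{A}^H=\{H\cap L\mid L\in\mathcal{A},L\ne H\}$, an arrangement in $H$ with $Q(\mathcal{A}^H)\in\overline S$ the product of its defining linear forms. The residue map $\mathrm{res}^H_{\mathcal{A}}:\Omega^1(\mathcal{A})\to\overline S$ is $$\mathrm{res}^H_{\mathcal{A}}\big(f\,d\alpha_H+f_2\,d\alpha_2+\cdots+f_\ell\,d\alpha_\ell\big)=\frac{1}{Q(\mathcal{A}^H)}\,\overline{Q(\mathcal{A})f},$$ where $\alpha_H,\alpha_2,\dots,\alpha_\ell$ is any basis of $V^*$ (this is well defined, independent of the choice of $\alpha_2,\dots,\alpha_\ell$, and takes values in $\overline S$). The residue ideal $J_{\mathcal{A}}^H\subset\overline S$ is the image of $\mathrm{res}^H_{\mathcal{A}}$. An empty intersection of ideals of $\overline S$ is $\overline S$. *)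

theory Defs
  imports
    "HOL-Library.Poly_Mapping"
    "HOL-Computational_Algebra.Polynomial_Factorial"
    "HOL-Algebra.Algebraic_Closure_Type"
    "HOL-Analysis.Cartesian_Space"
begin

section \<open>Polynomials and linear forms\<close>

text \<open>
  The finite index type \<^typ>\<open>'n\<close> plays the role of \<open>{1, ..., l}\<close>; its linear order is needed for
  the integral-domain instance of the polynomial ring, and hence for its field of fractions.
  Polynomials are finitely supported families of coefficients indexed by exponent vectors.
\<close>

type_synonym ('n, 'k) mpoly = "('n \<Rightarrow>\<^sub>0 nat) \<Rightarrow>\<^sub>0 'k"

text \<open>
  The type \<open>'k ^ 'n\<close>. The infix notation would constrain \<^typ>\<open>'n\<close> to the sort \<^class>\<open>finite\<close> only.
\<close>

type_synonym ('n, 'k) space = "('k, 'n) vec"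

definition pconst :: "'k::field \<Rightarrow> ('n::linorder, 'k) mpoly"
  where "pconst c = Poly_Mapping.single 0 c"

definition pvar :: "'n::linorder \<Rightarrow> ('n, 'k::field) mpoly"
  where "pvar i = Poly_Mapping.single (Poly_Mapping.single i 1) 1"

text \<open>
  A linear form \<open>\<Sum>i. c i * x i\<close> in the dual space of \<open>V = 'k ^ 'n\<close> is given by its coefficient vector
  \<open>c\<close>. Its value at \<open>v\<close> is \<^term>\<open>scalar_product c v\<close>; \<open>form_poly c\<close> is the same form as an element
  of the polynomial ring.
\<close>

definition form_poly :: "('n::{finite,linorder}, 'k::field) space \<Rightarrow> ('n, 'k) mpoly"
  where "form_poly c = (\<Sum>i\<in>UNIV. pconst (c $ i) * pvar i)"

text \<open>
  \<open>Y\<close> is the hyperplane cut out in the subspace \<open>U\<close> by the restriction to \<open>U\<close> of the form \<open>c\<close>.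
  The condition \<open>Y \<noteq> U\<close> says that this restriction is nonzero.
\<close>

definition defining_form :: "('k::field ^ 'n) set \<Rightarrow> ('k ^ 'n) set \<Rightarrow> 'k ^ 'n \<Rightarrow> bool"
  where "defining_form U Y c \<longleftrightarrow> Y = {v \<in> U. scalar_product c v = 0} \<and> Y \<noteq> U"

definition form_basis :: "('n::finite \<Rightarrow> 'k::field ^ 'n) \<Rightarrow> bool"
  where "form_basis b \<longleftrightarrow> inj b \<and> \<not> vec.dependent (range b) \<and> vec.span (range b) = UNIV"

section \<open>Differential forms\<close>

text \<open>
  A 1-form \<open>\<Sum>p. \<omega> p * dx p\<close> is given by its coefficient vector, a 2-form
  \<open>\<Sum>p<q. \<theta> p q * (dx p \<and> dx q)\<close> by the alternating matrix with entries \<open>\<theta> p q\<close> for \<open>p < q\<close>.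
  The vanishing of the diagonal is not redundant in characteristic 2.
\<close>

definition d_form :: "('n::{finite,linorder}, 'k::field) space \<Rightarrow> (('n, 'k) mpoly, 'n) vec"
  where "d_form c = (\<chi> p. pconst (c $ p))"

definition two_forms :: "('a::comm_ring_1 ^ 'n ^ 'n) set"
  where "two_forms = {\<theta>. \<forall>p q. \<theta> $ p $ p = 0 \<and> \<theta> $ p $ q = - \<theta> $ q $ p}"

definition wedge :: "'a::comm_ring_1 ^ 'n \<Rightarrow> 'a ^ 'n \<Rightarrow> 'a ^ 'n ^ 'n"
  where "wedge \<omega> \<eta> = (\<chi> p q. \<omega> $ p * \<eta> $ q - \<omega> $ q * \<eta> $ p)"

definition fract_form :: "'a::idom ^ 'n \<Rightarrow> 'a fract ^ 'n"
  where "fract_form \<eta> = (\<chi> p. to_fract (\<eta> $ p))"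

section \<open>Logarithmic forms and the residue ideal\<close>

text \<open>
  Throughout, \<open>\<alpha>\<close> is a choice of a defining form for each hyperplane of the arrangement \<open>A\<close>, and
  \<open>\<beta>\<close> is such a choice for the arrangement \<open>restriction A H\<close> in \<open>H\<close>, in which the
  forms on \<open>H\<close> are represented by forms on the whole space.
\<close>

definition Q_poly ::
  "('n::{finite,linorder}, 'k::field) space set set \<Rightarrow> (('n, 'k) space set \<Rightarrow> ('n, 'k) space)
    \<Rightarrow> ('n, 'k) mpoly"
  where "Q_poly A \<alpha> = (\<Prod>L\<in>A. form_poly (\<alpha> L))"

text \<open>Below, \<open>\<eta>\<close> is the polynomial form \<open>Q(A) \<omega>\<close>.\<close>

definition log_forms ::
  "('n::{finite,linorder}, 'k::field) space set set \<Rightarrow> (('n, 'k) space set \<Rightarrow> ('n, 'k) space)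
    \<Rightarrow> ((('n, 'k) mpoly fract, 'n) vec) set"
  where "log_forms A \<alpha> =
    {\<omega>. \<exists>\<eta>. \<omega> = inverse (to_fract (Q_poly A \<alpha>)) *s fract_form \<eta> \<and>
        (\<forall>L\<in>A. \<exists>\<theta>\<in>two_forms.
           wedge \<eta> (d_form (\<alpha> L)) = (\<chi> p q. form_poly (\<alpha> L) * \<theta> $ p $ q))}"

definition restriction :: "'v set set \<Rightarrow> 'v set \<Rightarrow> 'v set set"
  where "restriction A H = {H \<inter> L | L. L \<in> A \<and> L \<noteq> H}"

definition form_ideal :: "('n::{finite,linorder}, 'k::field) space \<Rightarrow> ('n, 'k) mpoly set"
  where "form_ideal c = PIdl\<^bsub>ring_of_type_algebra\<^esub> (form_poly c)"

definition quot_ring :: "('n::{finite,linorder}, 'k::field) space \<Rightarrow> ('n, 'k) mpoly set ring"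
  where "quot_ring c = ring_of_type_algebra Quot form_ideal c"

definition quot_class ::
  "('n::{finite,linorder}, 'k::field) space \<Rightarrow> ('n, 'k) mpoly \<Rightarrow> ('n, 'k) mpoly set"
  where "quot_class c g = form_ideal c +>\<^bsub>ring_of_type_algebra\<^esub> g"

definition Q_restr ::
  "('n::{finite,linorder}, 'k::field) space set set \<Rightarrow> (('n, 'k) space set \<Rightarrow> ('n, 'k) space)
    \<Rightarrow> ('n, 'k) space set
    \<Rightarrow> (('n, 'k) space set \<Rightarrow> ('n, 'k) space) \<Rightarrow> ('n, 'k) mpoly set"
  where "Q_restr A \<alpha> H \<beta> =
    (\<Otimes>\<^bsub>quot_ring (\<alpha> H)\<^esub>Y\<in>restriction A H. quot_class (\<alpha> H) (form_poly (\<beta> Y)))"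

text \<open>
  The residue of \<open>\<omega> = \<Sum>p. f p * d(b p)\<close>, where \<open>b\<close> is any basis of the dual space with \<open>b h = \<alpha> H\<close>,
  is the class \<open>r\<close> with \<open>Q(A^H) * r\<close> equal to the class of \<open>g = Q(A) * f h\<close>.
\<close>

definition residue ::
  "('n::{finite,linorder}, 'k::field) space set set \<Rightarrow> (('n, 'k) space set \<Rightarrow> ('n, 'k) space)
    \<Rightarrow> ('n, 'k) space set
    \<Rightarrow> (('n, 'k) space set \<Rightarrow> ('n, 'k) space) \<Rightarrow> (('n, 'k) mpoly fract, 'n) vec
    \<Rightarrow> ('n, 'k) mpoly set"
  where "residue A \<alpha> H \<beta> \<omega> =
    (THE r. r \<in> carrier (quot_ring (\<alpha> H)) \<and>
       (\<exists>b h f g. form_basis b \<and> b h = \<alpha> H \<and>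
          \<omega> = (\<Sum>p\<in>UNIV. f p *s fract_form (d_form (b p))) \<and>
          to_fract g = to_fract (Q_poly A \<alpha>) * f h \<and>
          Q_restr A \<alpha> H \<beta> \<otimes>\<^bsub>quot_ring (\<alpha> H)\<^esub> r = quot_class (\<alpha> H) g))"

definition residue_ideal ::
  "('n::{finite,linorder}, 'k::field) space set set \<Rightarrow> (('n, 'k) space set \<Rightarrow> ('n, 'k) space)
    \<Rightarrow> ('n, 'k) space set
    \<Rightarrow> (('n, 'k) space set \<Rightarrow> ('n, 'k) space) \<Rightarrow> ('n, 'k) mpoly set set"
  where "residue_ideal A \<alpha> H \<beta> = residue A \<alpha> H \<beta> ` log_forms A \<alpha>"

section \<open>Graphic arrangements\<close>

text \<open>A graph on the vertex set \<^typ>\<open>'n\<close> is given by its set of edges.\<close>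

definition simple_graph :: "'n set set \<Rightarrow> bool"
  where "simple_graph E \<longleftrightarrow> (\<forall>e\<in>E. card e = 2)"

definition coord_hyperplane :: "'n \<Rightarrow> 'n \<Rightarrow> ('k::field ^ 'n) set"
  where "coord_hyperplane u v = {x. x $ u = x $ v}"

definition graphic_arrangement :: "'n set set \<Rightarrow> ('k::field ^ 'n) set set"
  where "graphic_arrangement E = {coord_hyperplane u v | u v. {u, v} \<in> E}"

end

theory Submission
  imports Defs
begin

text \<open>
  Write a logarithmic form as \<open>\<eta> / Q\<close>. The defining conditions say that, for each edge \<open>{u, v}\<close>,
  \<open>x u - x v\<close> divides \<open>\<eta> p\<close> for \<open>p \<notin> {u, v}\<close> and \<open>\<eta> u + \<eta> v\<close>; the residue is, up to a constant,
  the class of \<open>\<eta> i\<close> divided by \<open>Q(A^H)\<close>.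

  For nonadjacent \<open>u, v \<in> W\<close>, write \<open>\<eta> i = (x u - x j) (x v - x j) a\<close> and
  \<open>\<eta> u = (x i - x j) (x v - x i) (x v - x j) c\<close>. As \<open>x u - x i\<close> divides \<open>\<eta> u + \<eta> i\<close>, the cofactor
  \<open>a\<close> lies in \<open>(x u - x i, x v - x i)\<close>, and so does the residue because the other factors of
  \<open>Q(A^H)\<close> are not in the prime ideal \<open>(y u, y v)\<close>.

  Conversely, the intersection of the ideals \<open>(y u, y v)\<close> is generated by the products of the \<open>y k\<close>
  over \<open>k \<in> W - K\<close>, where \<open>K \<subseteq> W\<close> is a clique. With \<open>C = K \<union> {i, j}\<close>, this product is up to a
  constant the residue of \<open>\<Sum>p\<in>C. dx p / (\<Prod>q\<in>C - {p}. x q - x p)\<close>.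
\<close>

unbundle no Formal_Power_Series.fps_syntax

section \<open>Renaming variables\<close>

text \<open>The exponent vector that \<open>m\<close> acquires when x_(s k) is substituted for x_k:
  exponents add up along the fibres of \<open>s\<close>. The endomorphism \<open>rename s\<close>
  built from it replaces passage to a quotient ring: for idempotent \<open>s\<close> it is a
  retraction whose kernel is generated by the x_k - x_(s k), so all computations stay in the domain
  S.\<close>

definition push_exp :: "('n::{finite,linorder} \<Rightarrow> 'n) \<Rightarrow> ('n \<Rightarrow>\<^sub>0 nat) \<Rightarrow> ('n \<Rightarrow>\<^sub>0 nat)"
  where "push_exp s m = (\<Sum>k\<in>UNIV. Poly_Mapping.single (s k) (Poly_Mapping.lookup m k))"

definition rename ::
  "('n::{finite,linorder} \<Rightarrow> 'n) \<Rightarrow> ('n, 'k::field) mpoly \<Rightarrow> ('n, 'k) mpoly"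
  where "rename s p = (\<Sum>m\<in>Poly_Mapping.keys p. Poly_Mapping.single (push_exp s m) (Poly_Mapping.lookup p m))"

lemma push_exp_add: "push_exp s (m + m') = push_exp s m + push_exp s m'"
  by (simp add: push_exp_def lookup_add single_add sum.distrib)

lemma push_exp_0: "push_exp s 0 = 0"
  by (simp add: push_exp_def)

lemma rename_superset:
  assumes "finite M" "Poly_Mapping.keys p \<subseteq> M"
  shows "rename s p = (\<Sum>m\<in>M. Poly_Mapping.single (push_exp s m) (Poly_Mapping.lookup p m))"
  unfolding rename_def
  by (rule sum.mono_neutral_left) (use assms in \<open>auto simp: in_keys_iff\<close>)

lemma rename_single: "rename s (Poly_Mapping.single m c) = Poly_Mapping.single (push_exp s m) c"
  by (subst rename_superset[of "{m}"]) auto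

lemma rename_0 [simp]: "rename s 0 = 0"
  by (simp add: rename_def)

lemma rename_add [simp]: "rename s (p + q) = rename s p + rename s q"
proof -
  let ?M = "Poly_Mapping.keys p \<union> Poly_Mapping.keys q"
  have "Poly_Mapping.keys (p + q) \<subseteq> ?M" by (rule Poly_Mapping.keys_add)
  then show ?thesis
    by (simp add: rename_superset[of ?M] lookup_add single_add sum.distrib)
qed

lemma rename_sum [simp]: "rename s (sum f F) = (\<Sum>x\<in>F. rename s (f x))"
  by (induction F rule: infinite_finite_induct) auto

lemma sum_monomials: "(\<Sum>m\<in>Poly_Mapping.keys p. Poly_Mapping.single m (Poly_Mapping.lookup p m)) = p"
  by (rule poly_mapping_eqI) (auto simp: lookup_sum lookup_single when_def in_keys_iff)

lemma rename_mult [simp]: "rename s (p * q) = rename s p * rename s q"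
proof -
  let ?S = "\<lambda>p. \<Sum>m\<in>Poly_Mapping.keys p. Poly_Mapping.single m (Poly_Mapping.lookup p m)"
  have "rename s (p * q) = rename s (?S p * ?S q)"
    by (simp only: sum_monomials)
  also have "\<dots> = rename s p * rename s q"
    unfolding sum_product rename_sum mult_single rename_single push_exp_add
    by (simp add: rename_def sum_product mult_single)
  finally show ?thesis .
qed

lemma pconst_0 [simp]: "pconst 0 = 0"
  and pconst_1 [simp]: "pconst 1 = 1"
  by (simp_all add: pconst_def)

lemma pconst_add: "pconst (a + b) = pconst a + pconst b"
  and pconst_diff: "pconst (a - b) = pconst a - pconst b"
  and pconst_uminus: "pconst (- a) = - pconst a"
  and pconst_mult: "pconst (a * b) = pconst a * pconst b"
  by (simp_all add: pconst_def single_add single_uminus single_diff mult_single)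

lemma pconst_eq_0_iff [simp]: "pconst c = 0 \<longleftrightarrow> c = 0"
  unfolding pconst_def by (metis lookup_single_eq lookup_zero single_zero)

lemma pconst_inverse: "c \<noteq> 0 \<Longrightarrow> pconst c * pconst (inverse c) = 1"
  by (simp flip: pconst_mult)

lemma pconst_mult_dvd_iff: "c \<noteq> 0 \<Longrightarrow> pconst c * p dvd q \<longleftrightarrow> p dvd q"
proof
  assume c: "c \<noteq> 0" and "p dvd q"
  then have "pconst c * p dvd pconst c * q" by (intro mult_dvd_mono dvd_refl)
  then have "pconst c * p dvd pconst (inverse c) * (pconst c * q)" by (rule dvd_mult)
  moreover have "pconst (inverse c) * (pconst c * q) = (pconst c * pconst (inverse c)) * q"
    by (simp only: ac_simps)
  ultimately show "pconst c * p dvd q"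
    by (simp only: pconst_inverse[OF c] mult_1)
qed (rule dvd_mult_right)

lemma rename_pconst [simp]: "rename s (pconst c) = pconst c"
  by (simp add: pconst_def rename_single push_exp_0)

lemma push_exp_single: "push_exp s (Poly_Mapping.single k e) = Poly_Mapping.single (s k) e"
proof -
  have "push_exp s (Poly_Mapping.single k e)
      = (\<Sum>l\<in>UNIV. if l = k then Poly_Mapping.single (s k) e else 0)"
    unfolding push_exp_def by (rule sum.cong) (auto simp: lookup_single when_def)
  then show ?thesis by simp
qed

lemma rename_pvar [simp]: "rename s (pvar k) = pvar (s k)"
  by (simp add: pvar_def rename_single push_exp_single)

lemma rename_1 [simp]: "rename s 1 = 1"
  by (metis pconst_1 rename_pconst)

lemma rename_uminus [simp]: "rename s (- p) = - rename s p"
  using rename_add[of s p "- p"] by (simp add: eq_neg_iff_add_eq_0 add.commute)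

lemma rename_diff [simp]: "rename s (p - q) = rename s p - rename s q"
  using rename_add[of s p "- q"] by simp

lemma rename_prod [simp]: "rename s (prod f F) = (\<Prod>x\<in>F. rename s (f x))"
  by (induction F rule: infinite_finite_induct) auto

lemma monomial_eq:
  fixes m :: "'n::{finite,linorder} \<Rightarrow>\<^sub>0 nat" and c :: "'a::field"
  shows "Poly_Mapping.single m c = pconst c * (\<Prod>k\<in>UNIV. pvar k ^ Poly_Mapping.lookup m k)"
proof -
  have pow: "pvar k ^ e = Poly_Mapping.single (Poly_Mapping.single k e) (1::'a)" for k :: 'n and e
    by (induction e) (simp_all add: pvar_def mult_single single_one flip: single_add)
  have pr: "(\<Prod>k\<in>F. pvar k ^ Poly_Mapping.lookup m k) =
      Poly_Mapping.single (\<Sum>k\<in>F. Poly_Mapping.single k (Poly_Mapping.lookup m k)) (1::'a)" if "finite F" for F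
    using that by induction (simp_all add: pow mult_single)
  have "(\<Sum>k\<in>UNIV. Poly_Mapping.single k (Poly_Mapping.lookup m k)) = m"
    by (rule poly_mapping_eqI) (auto simp: lookup_sum lookup_single when_def)
  then show ?thesis
    by (simp add: pr pconst_def mult_single)
qed

text \<open>Constants and variables generate S as a ring, so statements about substitutions reduce
  to these generators and to compatibility with sums and products.\<close>

lemma mpoly_induct [case_names const var add mult]:
  fixes p :: "('n::{finite,linorder}, 'k::field) mpoly"
  assumes const: "\<And>c. P (pconst c)" and var: "\<And>k. P (pvar k)"
    and add: "\<And>p q. P p \<Longrightarrow> P q \<Longrightarrow> P (p + q)" and mult: "\<And>p q. P p \<Longrightarrow> P q \<Longrightarrow> P (p * q)"
  shows "P p"
proof -
  have pow: "P (pvar k ^ e)" for k e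
    using const[of 1] by (induction e) (auto intro: var mult)
  have "P (\<Prod>k\<in>F. pvar k ^ Poly_Mapping.lookup m k)" if "finite F" for F m
    using that const[of 1] by induction (auto intro: pow mult)
  then have mon: "P (Poly_Mapping.single m c)" for m c
    by (auto simp: monomial_eq intro: const mult)
  have "P (\<Sum>m\<in>F. Poly_Mapping.single m (Poly_Mapping.lookup p m))" if "finite F" for F
    using that const[of 0] by induction (auto intro: mon add)
  then show ?thesis by (metis sum_monomials finite_keys)
qed

lemma rename_rename [simp]: "rename s (rename t p) = rename (s \<circ> t) p"
  by (induction p rule: mpoly_induct) auto

lemma rename_id: "(\<And>k. s k = k) \<Longrightarrow> rename s p = p"
  by (induction p rule: mpoly_induct) auto

section \<open>Reduction modulo a difference of two variables\<close>

lemma rename_dvd: "p dvd q \<Longrightarrow> rename t p dvd rename t q"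
  by (auto simp: dvd_def)

text \<open>On polynomials this is reduction modulo the ideal of all x_k - x_v with k in T.\<close>

definition collapse :: "'n set \<Rightarrow> 'n \<Rightarrow> 'n \<Rightarrow> 'n"
  where "collapse T v k = (if k \<in> T then v else k)"

lemma collapse_comp: "v \<notin> T \<Longrightarrow> collapse T v \<circ> collapse T' v = collapse (T \<union> T') v"
  by (auto simp: collapse_def)

definition lin :: "'n::linorder \<Rightarrow> 'n \<Rightarrow> ('n, 'k::field) mpoly"
  where "lin u v = pvar u - pvar v"

lemma rename_lin [simp]: "rename s (lin u v) = lin (s u) (s v)"
  by (simp add: lin_def)

lemma lin_self [simp]: "lin u u = 0"
  by (simp add: lin_def)

lemma lin_swap: "lin u v = - lin v u" by (simp add: lin_def)

lemma lin_dvd_swap: "lin u v dvd p \<longleftrightarrow> lin v u dvd p"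
  by (subst lin_swap) simp

lemma pvar_inj: "pvar u = (pvar v :: ('n::linorder, 'k::field) mpoly) \<longleftrightarrow> u = v"
proof
  assume "pvar u = (pvar v :: ('n, 'k) mpoly)"
  then have "Poly_Mapping.single u (1::nat) = Poly_Mapping.single v 1"
    by (metis keys_single pvar_def singleton_inject zero_neq_one)
  then show "u = v"
    by (metis keys_single singleton_inject zero_neq_one)
qed simp

lemma lin_eq_0_iff [simp]: "lin u v = 0 \<longleftrightarrow> u = v"
  by (simp add: lin_def pvar_inj)

text \<open>The substitution is a ring homomorphism congruent to the identity modulo x_u - x_v on
  generators; products are handled by pq - p'q' = (p - p')q + p'(q - q').\<close>

lemma lin_dvd_diff: "lin u v dvd p - rename (collapse {u} v) p"
proof (induction p rule: mpoly_induct)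
  case (add p q)
  have "p + q - rename (collapse {u} v) (p + q)
      = (p - rename (collapse {u} v) p) + (q - rename (collapse {u} v) q)"
    by (simp add: algebra_simps)
  then show ?case using add by (metis dvd_add)
next
  case (mult p q)
  have "p * q - rename (collapse {u} v) (p * q)
      = (p - rename (collapse {u} v) p) * q + rename (collapse {u} v) p * (q - rename (collapse {u} v) q)"
    by (simp add: algebra_simps)
  then show ?case using mult by (metis dvd_add dvd_mult dvd_mult2)
qed (auto simp: lin_def collapse_def)

text \<open>The kernel of the substitution is the principal ideal of x_u - x_v. Divisibility
  conditions on forms thereby become vanishing statements.\<close>

lemma lin_dvd_iff: "lin u v dvd p \<longleftrightarrow> rename (collapse {u} v) p = 0"
proof
  assume "lin u v dvd p"
  then show "rename (collapse {u} v) p = 0"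
    by (auto simp: dvd_def collapse_def)
next
  assume "rename (collapse {u} v) p = 0"
  then show "lin u v dvd p"
    using lin_dvd_diff[of u v p] by simp
qed

text \<open>The kernel of a homomorphism into a domain is a prime ideal.\<close>

lemma prime_elem_lin:
  assumes "u \<noteq> v" shows "prime_elem (lin u v :: ('n::{finite,linorder}, 'k::field) mpoly)"
proof (rule prime_elemI)
  show "\<not> (lin u v :: ('n, 'k) mpoly) dvd 1" by (simp add: lin_dvd_iff collapse_def)
qed (use assms in \<open>auto simp: lin_dvd_iff\<close>)

lemma prime_elem_scaled_lin:
  assumes "c \<noteq> 0" "u \<noteq> v"
  shows "prime_elem (pconst c * lin u v :: ('n::{finite,linorder}, 'k::field) mpoly)"
  using prime_elem_lin[OF assms(2), where 'k = 'k] assms(1)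
  by (simp add: prime_elem_def pconst_mult_dvd_iff)

lemma lin_dvd_lin_iff:
  assumes "u \<noteq> v" "p \<noteq> q"
  shows "lin u v dvd (lin p q :: ('n::{finite,linorder}, 'k::field) mpoly) \<longleftrightarrow> {u, v} = {p, q}"
  using assms by (auto simp: lin_dvd_iff collapse_def doubleton_eq_iff)

section \<open>Products of primes dividing a common element\<close>

lemma prime_elem_dvd_prod:
  fixes f :: "'b \<Rightarrow> 'a::idom"
  assumes "prime_elem p" "finite F"
  shows "p dvd prod f F \<longleftrightarrow> (\<exists>x\<in>F. p dvd f x)"
  using assms(2)
proof induction
  case empty
  then show ?case using assms(1) prime_elem_not_unit by auto
next
  case (insert x F)
  then show ?case by (simp add: prime_elem_dvd_mult_iff[OF assms(1)])
qed

text \<open>A prime that divides none of the other factors does not divide their product, so it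
  divides the cofactor supplied by the induction.\<close>

lemma prod_primes_dvd:
  fixes f :: "'b \<Rightarrow> 'a::idom"
  assumes "finite F" "\<And>x. x \<in> F \<Longrightarrow> prime_elem (f x)" "\<And>x. x \<in> F \<Longrightarrow> f x dvd g"
    "\<And>x y. x \<in> F \<Longrightarrow> y \<in> F \<Longrightarrow> x \<noteq> y \<Longrightarrow> \<not> f x dvd f y"
  shows "prod f F dvd g"
  using assms
proof (induction F)
  case (insert x F)
  then have "prod f F dvd g" by simp
  then obtain q where q: "g = prod f F * q" ..
  have "\<not> f x dvd prod f F"
    using insert by (auto simp: prime_elem_dvd_prod)
  then have "f x dvd q"
    using insert.prems(1)[of x] insert.prems(2)[of x] q prime_elem_dvd_multD by auto
  then have "f x * prod f F dvd q * prod f F" by (rule mult_dvd_mono) simp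
  then show ?case using insert(1,2) q by (simp add: mult.commute)
qed simp

lemma prime_elem_mult_dvd:
  fixes p g h :: "'a::idom"
  assumes "prime_elem p" "p dvd g" "h dvd g" "\<not> p dvd h"
  shows "h * p dvd g"
proof -
  obtain q where q: "g = h * q" using assms(3) ..
  then have "p dvd q" using assms prime_elem_dvd_multD by auto
  then show ?thesis by (simp add: q mult_dvd_mono)
qed

section \<open>Monomials complementary to cliques\<close>

text \<open>The ideals (y_u, y_v) over non-adjacent pairs intersect in the cover ideal of the
  complement graph on W, whose monomials are indexed by complements of cliques. The proof removes a
  vertex \<open>w\<close> and splits f = (f - f0) + f0, where \<open>f0\<close> has x_w replaced by
  x_i. Each summand has a forced factor, and the induction hypothesis is applied to its cofactor and
  to the colon ideal of Z by that factor; this is why Z is an arbitrary ideal.\<close>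

lemma clique_monomials_generate:
  fixes f :: "('n::{finite,linorder}, 'k::field) mpoly" and adj :: "'n \<Rightarrow> 'n \<Rightarrow> bool"
  assumes "symp adj" "i \<notin> W"
    and "\<And>p q. p \<in> Z \<Longrightarrow> q \<in> Z \<Longrightarrow> p + q \<in> Z"
    and "\<And>p q. q \<in> Z \<Longrightarrow> p * q \<in> Z"
    and "\<And>K. K \<subseteq> W \<Longrightarrow> (\<And>u v. u \<in> K \<Longrightarrow> v \<in> K \<Longrightarrow> u \<noteq> v \<Longrightarrow> adj u v)
      \<Longrightarrow> (\<Prod>k\<in>W - K. lin k i) \<in> Z"
    and "\<And>u v. u \<in> W \<Longrightarrow> v \<in> W \<Longrightarrow> u \<noteq> v \<Longrightarrow> \<not> adj u v \<Longrightarrow> rename (collapse {u, v} i) f = 0"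
  shows "f \<in> Z"
proof -
  have "finite W" by simp
  then show ?thesis
    using assms(2-)
  proof (induction W arbitrary: f Z rule: finite_psubset_induct)
    case (psubset W f Z)
    note i = psubset.prems(1) and Zadd = psubset.prems(2) and Zmult = psubset.prems(3)
      and Zclique = psubset.prems(4) and vanish = psubset.prems(5)
    show ?case
    proof (cases "W = {}")
      case True
      \<comment> \<open>The empty clique contributes the empty product.\<close>
      then have "1 \<in> Z" using Zclique[of "{}"] by simp
      then show ?thesis using Zmult[of 1 f] by simp
    next
      case False
      then obtain w where w: "w \<in> W" by auto
      define W' where "W' = W - {w}"
      define N where "N = {u \<in> W'. \<not> adj w u}"
      define f0 where "f0 = rename (collapse {w} i) f"
      have vanish0: "rename (collapse {u, v} i) f0 = 0"
        if "u \<in> W'" "v \<in> W'" "u \<noteq> v" "\<not> adj u v" for u v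
      proof -
        have "collapse {u, v} i \<circ> collapse {w} i = collapse {w} i \<circ> collapse {u, v} i"
          using that i w by (subst (1 2) collapse_comp) (auto simp: W'_def insert_commute)
        then have "rename (collapse {u, v} i) f0 = rename (collapse {w} i) (rename (collapse {u, v} i) f)"
          by (simp add: f0_def)
        then show ?thesis
          using vanish[of u v] that by (simp add: W'_def del: rename_rename)
      qed
      obtain f1 where f1: "f - f0 = lin w i * f1"
        using lin_dvd_diff[of w i f] by (auto simp: f0_def)
      \<comment> \<open>The complement in W of a clique K in \<open>W'\<close> still contains
        \<open>w\<close>, which accounts for the factor x_w - x_i.\<close>
      have "f1 \<in> {g. lin w i * g \<in> Z}"
      proof (rule psubset.IH[of W'])
        fix K assume K: "K \<subseteq> W'" "\<And>u v. u \<in> K \<Longrightarrow> v \<in> K \<Longrightarrow> u \<noteq> v \<Longrightarrow> adj u v"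
        have "W - K = insert w (W' - K)" "w \<notin> W' - K" using K w by (auto simp: W'_def)
        then have "(lin w i :: ('n, 'k) mpoly) * (\<Prod>k\<in>W' - K. lin k i) = (\<Prod>k\<in>W - K. lin k i)" by simp
        moreover have "(\<Prod>k\<in>W - K. lin k i) \<in> Z"
          by (rule Zclique) (use K in \<open>auto simp: W'_def\<close>)
        ultimately show "(\<Prod>k\<in>W' - K. lin k i) \<in> {g. lin w i * g \<in> Z}" by simp
      next
        fix u v assume uv: "u \<in> W'" "v \<in> W'" "u \<noteq> v" "\<not> adj u v"
        have "rename (collapse {u, v} i) (f - f0) = 0"
          using vanish0[of u v] vanish[of u v] uv by (simp add: W'_def)
        \<comment> \<open>Since w differs from u and v, x_w - x_i survives this substitution and
          cancels.\<close>
        then show "rename (collapse {u, v} i) f1 = 0"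
          using uv i w by (auto simp: f1 W'_def collapse_def)
      next
        fix p q assume "q \<in> {g. lin w i * g \<in> Z}"
        then show "p * q \<in> {g. lin w i * g \<in> Z}"
          using Zmult[of "lin w i * q" p] by (simp add: algebra_simps)
      qed (use w i Zadd in \<open>auto simp: W'_def distrib_left\<close>)
      then have f1Z: "f - f0 \<in> Z" by (simp add: f1)
      \<comment> \<open>Setting x_u = x_i in \<open>f0\<close> amounts to setting x_u = x_w = x_i in
        f, which gives 0 for every u not adjacent to w.\<close>
      have "(\<Prod>u\<in>N. lin u i) dvd f0"
      proof (rule prod_primes_dvd)
        fix u assume u: "u \<in> N"
        then show "prime_elem (lin u i :: ('n, 'k) mpoly)"
          using i by (intro prime_elem_lin) (auto simp: N_def W'_def)
        have "collapse {u} i \<circ> collapse {w} i = collapse {w, u} i"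
          using u i by (subst collapse_comp) (auto simp: N_def W'_def insert_commute)
        then show "lin u i dvd f0"
          using vanish[of w u] u w by (auto simp: lin_dvd_iff f0_def N_def W'_def)
      next
        fix u v assume "u \<in> N" "v \<in> N" "u \<noteq> v"
        then show "\<not> lin u i dvd (lin v i :: ('n, 'k) mpoly)"
          using i by (subst lin_dvd_lin_iff) (auto simp: N_def W'_def doubleton_eq_iff)
      qed simp
      then obtain f2 where f2: "f0 = (\<Prod>u\<in>N. lin u i) * f2" ..
      have "f2 \<in> {g. (\<Prod>u\<in>N. lin u i) * g \<in> Z}"
      proof (rule psubset.IH[of "W' - N"])
        fix K assume K: "K \<subseteq> W' - N" "\<And>u v. u \<in> K \<Longrightarrow> v \<in> K \<Longrightarrow> u \<noteq> v \<Longrightarrow> adj u v"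
        \<comment> \<open>Every vertex of \<open>W' - N\<close> is adjacent to w, so K with w added
          is again a clique; its complement contains N, the source of the extracted factor.\<close>
        have "W - insert w K = N \<union> (W' - N - K)" using K by (auto simp: W'_def N_def)
        then have "(\<Prod>u\<in>N. lin u i :: ('n, 'k) mpoly) * (\<Prod>k\<in>W' - N - K. lin k i) = (\<Prod>k\<in>W - insert w K. lin k i)"
          by (simp add: prod.union_disjoint Diff_Int_distrib)
        moreover have "(\<Prod>k\<in>W - insert w K. lin k i) \<in> Z"
        proof (rule Zclique)
          fix u v assume "u \<in> insert w K" "v \<in> insert w K" "u \<noteq> v"
          then show "adj u v"
            using K sympD[OF \<open>symp adj\<close>] by (auto simp: N_def)
        qed (use K w in \<open>auto simp: W'_def\<close>)
        ultimately show "(\<Prod>k\<in>W' - N - K. lin k i) \<in> {g. (\<Prod>u\<in>N. lin u i) * g \<in> Z}" by simp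
      next
        fix u v assume uv: "u \<in> W' - N" "v \<in> W' - N" "u \<noteq> v" "\<not> adj u v"
        have "(\<Prod>k\<in>N. lin (collapse {u, v} i k) (collapse {u, v} i i)) \<noteq> (0 :: ('n, 'k) mpoly)"
          using uv i by (auto simp: N_def W'_def collapse_def)
        moreover have "rename (collapse {u, v} i) f0 = 0"
          using vanish0[of u v] uv by simp
        ultimately show "rename (collapse {u, v} i) f2 = 0"
          by (simp add: f2)
      next
        fix p q assume "q \<in> {g. (\<Prod>u\<in>N. lin u i) * g \<in> Z}"
        then show "p * q \<in> {g. (\<Prod>u\<in>N. lin u i) * g \<in> Z}"
          using Zmult[of "(\<Prod>u\<in>N. lin u i) * q" p] by (simp add: algebra_simps)
      qed (use w i Zadd in \<open>auto simp: W'_def distrib_left\<close>)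
      then have "f0 \<in> Z" by (simp add: f2)
      from Zadd[OF f1Z this] show ?thesis by simp
    qed
  qed
qed

section \<open>Defining forms and the logarithmic condition\<close>

lemma scalar_product_add_right: "scalar_product a (x + y) = scalar_product a x + scalar_product a y"
  by (simp add: scalar_product_def distrib_left sum.distrib)

lemma sum_fibres:
  fixes g :: "'n::finite \<Rightarrow> 'n \<Rightarrow> 'a::comm_monoid_add"
  shows "(\<Sum>k\<in>UNIV. g k (s k)) = (\<Sum>p\<in>UNIV. \<Sum>k | s k = p. g k p)"
proof -
  have "(\<Sum>p\<in>UNIV. \<Sum>k | s k = p. g k p) = (\<Sum>p\<in>UNIV. \<Sum>k\<in>{k \<in> UNIV. s k = p}. g k (s k))"
    by (intro sum.cong) auto
  then show ?thesis using sum.group[of UNIV UNIV s "\<lambda>k. g k (s k)"] by simp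
qed

text \<open>
  The subspace of vectors constant on the fibres of an idempotent \<open>s\<close> is the whole space for
  \<open>s = id\<close> and the hyperplane \<open>H\<close> for \<open>s = id(j := i)\<close>.
\<close>

lemma defining_form_coeffs:
  fixes a :: "'k::field ^ 'n"
  assumes s: "\<And>k. s (s k) = s k"
    and a: "defining_form {x. \<forall>k. x $ s k = x $ k} {x. (\<forall>k. x $ s k = x $ k) \<and> x $ u = x $ v} a"
  obtains c where "c \<noteq> 0"
    "\<And>p. (\<Sum>k | s k = p. a $ k) = (if p = s u then c else if p = s v then - c else 0)"
proof -
  define U where "U = {x :: 'k ^ 'n. \<forall>k. x $ s k = x $ k}"
  \<comment> \<open>Indicator vectors of the fibres of \<open>s\<close>; they lie in U, and the form
    takes the value \<open>F p\<close> on \<open>e p\<close>.\<close>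
  define e where "e p = (\<chi> k. if s k = p then 1 else (0::'k))" for p
  define F where "F p = (\<Sum>k | s k = p. a $ k)" for p
  have hyper: "scalar_product a x = 0 \<longleftrightarrow> x $ u = x $ v" if "x \<in> U" for x
    using a that unfolding defining_form_def U_def by blast
  obtain x where x: "x \<in> U" "x $ u \<noteq> x $ v"
    using a unfolding defining_form_def U_def by blast
  have suv: "s u \<noteq> s v" using x by (metis (mono_tags, lifting) U_def mem_Collect_eq)
  have eU: "e p \<in> U" for p by (simp add: U_def e_def s)
  have Fe: "scalar_product a (e p) = F p" for p
    by (simp add: scalar_product_def e_def F_def if_distrib sum.If_cases cong: if_cong)
  \<comment> \<open>The indicator of any fibre not containing u or v lies in the hyperplane, and so
    does the sum of the two remaining indicators; this fixes F up to one scalar.\<close>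
  have F0: "F p = 0" if "p \<noteq> s u" "p \<noteq> s v" for p
    using hyper[OF eU, of p] that by (simp add: Fe) (simp add: e_def)
  have "e (s u) + e (s v) \<in> U" using eU by (simp add: U_def)
  then have "F (s u) + F (s v) = 0"
    using hyper[of "e (s u) + e (s v)"] suv by (simp add: scalar_product_add_right Fe) (simp add: e_def)
  then have Fv: "F (s v) = - F (s u)" by (simp add: eq_neg_iff_add_eq_0 add.commute)
  have F: "F p = (if p = s u then F (s u) else if p = s v then - F (s u) else 0)" for p
    using F0 Fv by auto
  \<comment> \<open>On U the form depends on F alone, so a zero scalar would make it vanish at the
    vector x outside the hyperplane.\<close>
  have "scalar_product a x = (\<Sum>k\<in>UNIV. a $ k * x $ s k)"
    using x by (simp add: scalar_product_def U_def)
  also have "\<dots> = (\<Sum>p\<in>UNIV. F p * x $ p)"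
    by (subst sum_fibres) (simp add: F_def sum_distrib_right)
  finally have "F (s u) \<noteq> 0"
    using hyper[OF x(1)] x(2) F by (metis (no_types, lifting) minus_zero mult_zero_left sum.neutral)
  then show ?thesis using that[of "F (s u)"] F unfolding F_def by blast
qed

text \<open>Substitution adds the coefficients along the fibres of \<open>s\<close>, which are
  exactly the sums computed in \<open>defining_form_coeffs\<close>.\<close>

lemma rename_form_poly:
  assumes "\<And>p. (\<Sum>k | s k = p. a $ k) = (if p = u then c else if p = v then - c else 0)" "u \<noteq> v"
  shows "rename s (form_poly a) = pconst c * lin u v"
proof -
  have pconst_sum: "(\<Sum>k\<in>T. pconst (a $ k)) = pconst (\<Sum>k\<in>T. a $ k)" for T
    by (induction T rule: infinite_finite_induct) (auto simp: pconst_add)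
  have "rename s (form_poly a) = (\<Sum>p\<in>UNIV. pconst (\<Sum>k | s k = p. a $ k) * pvar p)"
    by (simp add: form_poly_def, subst sum_fibres) (simp add: pconst_sum flip: sum_distrib_right)
  also have "\<dots> = (\<Sum>p\<in>UNIV. (if p = u then pconst c * pvar u else 0)
                        - (if p = v then pconst c * pvar v else 0))"
    using assms by (intro sum.cong) (auto simp: pconst_uminus)
  also have "\<dots> = pconst c * lin u v"
    by (simp add: sum_subtractf lin_def algebra_simps)
  finally show ?thesis .
qed

text \<open>For a = c (x_u - x_v), the entries of the wedge product are, up to sign, c times the
  components of \<eta> off the edge and c (\<eta>_u + \<eta>_v), or zero.\<close>

lemma wedge_dvd_iff:
  fixes \<eta> :: "(('n::{finite,linorder}, 'k::field) mpoly, 'n) vec"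
  assumes a: "\<And>k. a $ k = (if k = u then c else if k = v then - c else 0)" and "u \<noteq> v" "c \<noteq> 0"
  shows "(\<exists>\<theta>\<in>two_forms. wedge \<eta> (d_form a) = (\<chi> p q. form_poly a * \<theta> $ p $ q)) \<longleftrightarrow>
    (\<forall>p. p \<noteq> u \<longrightarrow> p \<noteq> v \<longrightarrow> lin u v dvd \<eta> $ p) \<and> lin u v dvd \<eta> $ u + \<eta> $ v"
proof -
  have form: "form_poly a = pconst c * lin u v"
    using rename_form_poly[where s = id and a = a and u = u and v = v and c = c] a assms(2) by (simp add: rename_id)
  then have form0: "form_poly a \<noteq> 0" using assms by simp
  have lin_form: "form_poly a dvd p \<longleftrightarrow> lin u v dvd p" for p
    using \<open>c \<noteq> 0\<close> by (simp add: form pconst_mult_dvd_iff)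
  have lin_pconst: "lin u v dvd pconst c * p \<longleftrightarrow> lin u v dvd p" for p
    using \<open>c \<noteq> 0\<close> by (simp add: lin_dvd_iff)
  define M where "M p q = \<eta> $ p * pconst (a $ q) - \<eta> $ q * pconst (a $ p)" for p q
  have "(\<exists>\<theta>\<in>two_forms. wedge \<eta> (d_form a) = (\<chi> p q. form_poly a * \<theta> $ p $ q)) \<longleftrightarrow>
    (\<forall>p q. lin u v dvd M p q)"
  proof
    assume "\<exists>\<theta>\<in>two_forms. wedge \<eta> (d_form a) = (\<chi> p q. form_poly a * \<theta> $ p $ q)"
    then obtain \<theta> where "wedge \<eta> (d_form a) = (\<chi> p q. form_poly a * \<theta> $ p $ q)" by blast
    then have "M p q = form_poly a * \<theta> $ p $ q" for p q
      by (simp add: wedge_def d_form_def vec_eq_iff M_def)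
    then show "\<forall>p q. lin u v dvd M p q" by (simp flip: lin_form)
  next
    assume "\<forall>p q. lin u v dvd M p q"
    then have "\<forall>p q. form_poly a dvd M p q" using lin_form by blast
    then have "\<forall>p q. \<exists>t. M p q = form_poly a * t" unfolding dvd_def .
    then obtain t where t: "\<And>p q. M p q = form_poly a * t p q" by metis
    \<comment> \<open>The quotient matrix inherits the zero diagonal and the antisymmetry because
      the nonzero linear form cancels; the diagonal is treated separately because of characteristic
      2.\<close>
    have "form_poly a * t p p = form_poly a * 0" for p
      by (simp only: t[symmetric]) (simp add: M_def)
    then have diag: "t p p = 0" for p
      using mult_left_cancel[OF form0] by blast
    have "form_poly a * t p q = form_poly a * (- t q p)" for p q
      by (simp only: mult_minus_right t[symmetric]) (simp add: M_def)
    then have "t p q = - t q p" for p q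
      using mult_left_cancel[OF form0] by blast
    then have "(\<chi> p q. t p q) \<in> two_forms"
      unfolding two_forms_def mem_Collect_eq vec_lambda_beta using diag by blast
    moreover have "wedge \<eta> (d_form a) = (\<chi> p q. form_poly a * (\<chi> p q. t p q) $ p $ q)"
      by (simp add: wedge_def d_form_def vec_eq_iff flip: t) (simp add: M_def)
    ultimately show "\<exists>\<theta>\<in>two_forms. wedge \<eta> (d_form a) = (\<chi> p q. form_poly a * \<theta> $ p $ q)"
      by blast
  qed
  also have "\<dots> \<longleftrightarrow> (\<forall>p. p \<noteq> u \<longrightarrow> p \<noteq> v \<longrightarrow> lin u v dvd \<eta> $ p) \<and> lin u v dvd \<eta> $ u + \<eta> $ v"
  proof (intro iffI conjI allI impI)
    assume M: "\<forall>p q. lin u v dvd M p q"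
    show "lin u v dvd \<eta> $ p" if "p \<noteq> u" "p \<noteq> v" for p
    proof -
      have "M p u = pconst c * \<eta> $ p" using that by (simp add: M_def a mult.commute)
      then show ?thesis using M lin_pconst by metis
    qed
    have "- M u v = pconst c * (\<eta> $ u + \<eta> $ v)"
      using assms(2) by (simp add: M_def a pconst_uminus algebra_simps)
    then show "lin u v dvd \<eta> $ u + \<eta> $ v" using M lin_pconst dvd_minus_iff by metis
  next
    fix p q assume *: "(\<forall>p. p \<noteq> u \<longrightarrow> p \<noteq> v \<longrightarrow> lin u v dvd \<eta> $ p) \<and> lin u v dvd \<eta> $ u + \<eta> $ v"
    \<comment> \<open>Modulo x_u - x_v the vector \<eta> becomes proportional to the coefficient
      vector of a, so the two-by-two minors M vanish.\<close>
    define r :: "('n, 'k) mpoly \<Rightarrow> ('n, 'k) mpoly" where "r = rename (collapse {u} v)"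
    have r0: "r (\<eta> $ p) = 0" if "p \<noteq> u" "p \<noteq> v" for p
      using * that by (simp add: lin_dvd_iff r_def)
    have rv: "r (\<eta> $ v) = - r (\<eta> $ u)"
      using * by (simp add: lin_dvd_iff r_def eq_neg_iff_add_eq_0 add.commute)
    have "r (\<eta> $ p) * pconst (a $ q) - r (\<eta> $ q) * pconst (a $ p) = 0"
      using assms(2) by (cases "p = u"; cases "p = v"; cases "q = u"; cases "q = v")
        (auto simp: a r0 rv pconst_uminus)
    then show "lin u v dvd M p q"
      by (simp add: lin_dvd_iff M_def r_def)
  qed
  finally show ?thesis .
qed

section \<open>Bases of the dual space and coordinate hyperplanes\<close>

lemma form_basis_dual_vector:
  fixes b :: "'n \<Rightarrow> 'k::field ^ 'n"
  assumes "form_basis b"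
  obtains w where "\<And>p. scalar_product (b p) w = (if p = h then 1 else 0)"
proof -
  define M where "M = (\<chi> p. b p)"
  have "rows M = range b" by (auto simp: rows_def row_def M_def vec_nth_inverse)
  then obtain B where "B ** M = mat 1"
    using assms matrix_left_invertible_span_rows_gen[of M] by (auto simp: form_basis_def)
  then have "M ** B = mat 1" by (simp add: matrix_left_right_inverse)
  \<comment> \<open>Column h of the inverse matrix is dual to \<open>b h\<close>: pairing a 1-form
    with it reads off the coefficient of d(b h).\<close>
  then have "(M ** B) $ p $ h = (if p = h then 1 else 0)" for p by (simp add: mat_def)
  then show ?thesis
    using that[of "\<chi> k. B $ k $ h"] by (simp add: matrix_matrix_mult_def scalar_product_def M_def)
qed

text \<open>Steinitz exchange: a takes the place of the i-th coordinate form, which can be recovered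
  from a and the others by dividing by the nonzero a_i.\<close>

lemma form_basis_exchange:
  fixes a :: "'k::field ^ 'n"
  assumes "a $ i \<noteq> 0"
  shows "form_basis (\<lambda>p. if p = i then a else axis p 1)" (is "form_basis ?b")
proof -
  have inj: "inj ?b"
  proof (rule injI)
    fix p q assume eq: "?b p = ?b q"
    have "a \<noteq> axis p 1" if "p \<noteq> i" for p
      using assms that by (auto simp: axis_def)
    then show "p = q"
      using eq by (metis axis_eq_axis zero_neq_one)
  qed
  let ?S = "vec.span (range ?b)"
  have ax0: "axis p 1 \<in> ?S" if "p \<noteq> i" for p
    using vec.span_base[of "?b p" "range ?b"] that by simp
  have "axis i 1 \<in> ?S"
  proof -
    have "a = (\<Sum>p\<in>UNIV. a $ p *s axis p 1)" by (simp add: basis_expansion)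
    also have "\<dots> = a $ i *s axis i 1 + (\<Sum>p\<in>UNIV - {i}. a $ p *s axis p 1)"
      by (simp add: sum.remove)
    finally have a: "a $ i *s axis i 1 = a - (\<Sum>p\<in>UNIV - {i}. a $ p *s axis p 1)"
      by (metis add_diff_cancel_right')
    have "(\<Sum>p\<in>UNIV - {i}. a $ p *s axis p 1) \<in> ?S"
      by (intro vec.span_sum vec.span_scale ax0) simp
    moreover have "a \<in> ?S" using vec.span_base[of "?b i" "range ?b"] by simp
    ultimately have "inverse (a $ i) *s (a $ i *s axis i 1) \<in> ?S"
      unfolding a by (intro vec.span_scale vec.span_diff)
    then show ?thesis using assms by (simp add: vector_smult_assoc)
  qed
  then have ax: "axis p 1 \<in> ?S" for p using ax0 by (cases "p = i") auto
  have "x \<in> ?S" for x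
  proof -
    have "(\<Sum>p\<in>UNIV. x $ p *s axis p 1) \<in> ?S"
      by (intro vec.span_sum vec.span_scale ax)
    then show ?thesis by (simp add: basis_expansion)
  qed
  then have span: "?S = UNIV" by auto
  \<comment> \<open>A spanning set with as many elements as the dimension is independent.\<close>
  have "card (range ?b) = vec.dim (UNIV :: ('k ^ 'n) set)"
    unfolding vec_dim_card by (rule card_image[OF inj])
  then have "\<not> vec.dependent (range ?b)"
    by (intro vec.card_le_dim_spanning[of _ UNIV]) (unfold span, simp_all only: finite subset_UNIV order_refl finite_imageI finite_class.finite_UNIV)
  then show ?thesis unfolding form_basis_def using inj span by blast
qed

lemma coord_hyperplane_eq_iff:
  assumes "u \<noteq> v" "p \<noteq> q"
  shows "coord_hyperplane u v = (coord_hyperplane p q :: ('k::field ^ 'n) set) \<longleftrightarrow> {u, v} = {p, q}"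
proof
  assume eq: "coord_hyperplane u v = (coord_hyperplane p q :: ('k ^ 'n) set)"
  \<comment> \<open>The pair {u, v} is recovered as the set of standard basis vectors missed by the
    hyperplane.\<close>
  have *: "(axis k (1::'k) :: 'k ^ 'n) \<in> coord_hyperplane u v \<longleftrightarrow> k \<noteq> u \<and> k \<noteq> v" if "u \<noteq> v" for k u v :: 'n
    using that by (auto simp: coord_hyperplane_def axis_def)
  show "{u, v} = {p, q}"
    using *[OF assms(1)] *[OF assms(2)] eq by blast
qed (auto simp: coord_hyperplane_def doubleton_eq_iff)

section \<open>The quotient by a linear form\<close>

lemma ring_of_type_algebra_simps:
  "carrier ring_of_type_algebra = UNIV"
  "x \<otimes>\<^bsub>ring_of_type_algebra\<^esub> y = x * y"
  "x \<oplus>\<^bsub>ring_of_type_algebra\<^esub> y = x + y"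
  "\<one>\<^bsub>ring_of_type_algebra\<^esub> = 1" "\<zero>\<^bsub>ring_of_type_algebra\<^esub> = 0"
  by (simp_all add: ring_of_type_algebra_def)

lemma finprod_ring_of_type_algebra:
  fixes f :: "'b \<Rightarrow> 'a::comm_ring_1"
  shows "finprod ring_of_type_algebra f F = prod f F"
proof -
  interpret R: cring "ring_of_type_algebra :: 'a ring" ..
  show ?thesis
    by (induction F rule: infinite_finite_induct)
      (simp_all add: ring_of_type_algebra_simps R.finprod_infinite)
qed

context
  fixes c :: "('n::{finite,linorder}, 'k::field) space"
begin

interpretation R: cring "ring_of_type_algebra :: ('n, 'k) mpoly ring" ..

lemma form_ideal_eq: "form_ideal c = {g. form_poly c dvd g}"
  by (auto simp: form_ideal_def cgenideal_def ring_of_type_algebra_simps dvd_def mult.commute)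

lemma ideal_form_ideal: "ideal (form_ideal c) ring_of_type_algebra"
  unfolding form_ideal_def by (rule R.cgenideal_ideal) (simp add: ring_of_type_algebra_simps)

interpretation I: ideal "form_ideal c" ring_of_type_algebra by (rule ideal_form_ideal)

interpretation Q: cring "quot_ring c"
  unfolding quot_ring_def by (rule I.quotient_is_cring) (rule R.is_cring)

interpretation q: ring_hom_cring ring_of_type_algebra "quot_ring c" "quot_class c"
proof -
  have "quot_class c = (+>\<^bsub>ring_of_type_algebra\<^esub>) (form_ideal c)" by (simp add: quot_class_def fun_eq_iff)
  then show "ring_hom_cring ring_of_type_algebra (quot_ring c) (quot_class c)"
    using I.rcos_ring_hom_cring[OF R.is_cring] by (simp add: quot_ring_def)
qed

lemma quot_class_mult: "quot_class c (f * g) = quot_class c f \<otimes>\<^bsub>quot_ring c\<^esub> quot_class c g"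
  using q.hom_mult[of f g] by (simp add: ring_of_type_algebra_simps)

lemma quot_class_add: "quot_class c (f + g) = quot_class c f \<oplus>\<^bsub>quot_ring c\<^esub> quot_class c g"
  using q.hom_add[of f g] by (simp add: ring_of_type_algebra_simps)

lemma quot_class_prod:
  "(\<Otimes>\<^bsub>quot_ring c\<^esub>x\<in>F. quot_class c (f x)) = quot_class c (prod f F)"
  using q.hom_finprod[of f F] by (simp add: finprod_ring_of_type_algebra ring_of_type_algebra_simps comp_def)

lemma carrier_quot_ring: "carrier (quot_ring c) = range (quot_class c)"
  by (auto simp: quot_ring_def quot_class_def FactRing_def A_RCOSETS_def' ring_of_type_algebra_simps)

lemma quot_class_eq_iff: "quot_class c f = quot_class c g \<longleftrightarrow> form_poly c dvd f - g"
proof -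
  have "f \<ominus>\<^bsub>ring_of_type_algebra\<^esub> g = f - g"
  proof -
    have "\<ominus>\<^bsub>ring_of_type_algebra\<^esub> g = - g"
      by (rule R.minus_equality) (simp_all add: ring_of_type_algebra_simps)
    then show ?thesis by (simp add: R.minus_eq ring_of_type_algebra_simps)
  qed
  then show ?thesis
    using R.quotient_eq_iff_same_a_r_cos[OF ideal_form_ideal, of f g]
    by (auto simp: quot_class_def form_ideal_eq ring_of_type_algebra_simps)
qed

text \<open>The ideal generated by two classes is the sum of the two principal ideals; lifting
  representatives turns membership into a polynomial identity with a correction term in the ideal of
  c.\<close>

lemma quot_class_in_genideal_iff:
  "quot_class c g \<in> Idl\<^bsub>quot_ring c\<^esub> {quot_class c g1, quot_class c g2} \<longleftrightarrow>
    (\<exists>a b d. g = form_poly c * d + g1 * a + g2 * b)" (is "_ \<in> ?I \<longleftrightarrow> _")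
proof -
  have carr: "quot_class c h \<in> carrier (quot_ring c)" for h by (simp add: carrier_quot_ring)
  interpret J: ideal ?I "quot_ring c"
    by (rule Q.genideal_ideal) (auto simp: carr)
  let ?P = "PIdl\<^bsub>quot_ring c\<^esub> (quot_class c g1) <+>\<^bsub>quot_ring c\<^esub> PIdl\<^bsub>quot_ring c\<^esub> (quot_class c g2)"
  have gen: "quot_class c g1 \<in> ?I" "quot_class c g2 \<in> ?I"
    using Q.genideal_self[of "{quot_class c g1, quot_class c g2}"] carr by auto
  have id: "ideal (PIdl\<^bsub>quot_ring c\<^esub> (quot_class c h)) (quot_ring c)" for h
    by (rule Q.cgenideal_ideal) (rule carr)
  have "?I \<subseteq> ?P"
  proof (rule Q.genideal_minimal)
    show "ideal ?P (quot_ring c)"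
      by (rule Q.add_ideals) (rule id)+
    have z: "\<zero>\<^bsub>quot_ring c\<^esub> \<in> PIdl\<^bsub>quot_ring c\<^esub> (quot_class c h)" for h
      using additive_subgroup.zero_closed[OF ideal.axioms(1)[OF id]] .
    have "quot_class c g1 \<oplus>\<^bsub>quot_ring c\<^esub> \<zero>\<^bsub>quot_ring c\<^esub> \<in> ?P"
      "\<zero>\<^bsub>quot_ring c\<^esub> \<oplus>\<^bsub>quot_ring c\<^esub> quot_class c g2 \<in> ?P"
      unfolding set_add_def' using Q.cgenideal_self[OF carr] z by blast+
    then show "{quot_class c g1, quot_class c g2} \<subseteq> ?P"
      by (simp add: carr)
  qed
  moreover have "\<exists>a b. h = quot_class c (g1 * a + g2 * b)" if h: "h \<in> ?P" for h
  proof -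
    obtain x y where x: "x \<in> PIdl\<^bsub>quot_ring c\<^esub> (quot_class c g1)"
      and y: "y \<in> PIdl\<^bsub>quot_ring c\<^esub> (quot_class c g2)" and xy: "h = x \<oplus>\<^bsub>quot_ring c\<^esub> y"
      using h unfolding set_add_def' by blast
    obtain a where "x = quot_class c a \<otimes>\<^bsub>quot_ring c\<^esub> quot_class c g1"
      using x unfolding cgenideal_def carrier_quot_ring by blast
    moreover obtain b where "y = quot_class c b \<otimes>\<^bsub>quot_ring c\<^esub> quot_class c g2"
      using y unfolding cgenideal_def carrier_quot_ring by blast
    ultimately have "h = quot_class c (g1 * a + g2 * b)"
      by (simp add: xy quot_class_add quot_class_mult mult.commute flip: quot_class_mult)
    then show ?thesis by blast
  qed
  ultimately have "quot_class c g \<in> ?I \<Longrightarrow> \<exists>a b. quot_class c g = quot_class c (g1 * a + g2 * b)"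
    by blast
  moreover have "quot_class c (g1 * a + g2 * b) \<in> ?I" for a b
    using J.I_r_closed[OF gen(1) carr] J.I_r_closed[OF gen(2) carr] J.a_closed
    by (simp add: quot_class_add quot_class_mult)
  ultimately have "quot_class c g \<in> ?I \<longleftrightarrow> (\<exists>a b. quot_class c g = quot_class c (g1 * a + g2 * b))"
    by metis
  also have "\<dots> \<longleftrightarrow> (\<exists>a b d. g = form_poly c * d + g1 * a + g2 * b)"
    by (auto simp: quot_class_eq_iff dvd_def algebra_simps)
  finally show ?thesis .
qed

end

section \<open>Residues along a hyperplane of a graphic arrangement\<close>

locale graphic_hyperplane =
  fixes E :: "'n::{finite,linorder} set set"
    and i j :: 'n
    and A :: "('n, 'k::field) space set set"
    and H :: "('n, 'k) space set"
    and W :: "'n set"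
    and \<alpha> \<beta> :: "('n, 'k) space set \<Rightarrow> ('n, 'k) space"
  assumes graph: "simple_graph E"
    and edge: "{i, j} \<in> E"
    and A: "A = graphic_arrangement E"
    and H: "H = coord_hyperplane i j"
    and \<alpha>: "\<And>L. L \<in> A \<Longrightarrow> defining_form UNIV L (\<alpha> L)"
    and \<beta>: "\<And>Y. Y \<in> restriction A H \<Longrightarrow> defining_form H Y (\<beta> Y)"
    and W: "W = {k. {k, i} \<in> E \<and> {k, j} \<in> E}"
begin

text \<open>Setting x_j = x_i: \<open>rename s\<close> selects, in each class modulo x_i - x_j, the
  representative without x_j.\<close>

abbreviation s :: "'n \<Rightarrow> 'n" where "s \<equiv> collapse {j} i"

abbreviation Q :: "('n, 'k) mpoly" where "Q \<equiv> Q_poly A \<alpha>"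

text \<open>A polynomial lift of Q(A^H). Only \<open>rename s P\<close> is meaningful, since the
  forms \<beta> matter only on H.\<close>

definition P :: "('n, 'k) mpoly" where "P = (\<Prod>Y\<in>restriction A H. form_poly (\<beta> Y))"

lemma edge_neq: "{u, v} \<in> E \<Longrightarrow> u \<noteq> v"
  using graph by (force simp: simple_graph_def)

lemma i_neq_j: "i \<noteq> j" using edge edge_neq by blast

lemma finite_A: "finite A"
  by (rule finite_subset[of _ "(\<lambda>(u, v). coord_hyperplane u v) ` UNIV"])
    (auto simp: A graphic_arrangement_def)

lemma A_iff: "L \<in> A \<longleftrightarrow> (\<exists>u v. {u, v} \<in> E \<and> L = coord_hyperplane u v)"
  by (auto simp: A graphic_arrangement_def)

lemma hyperplane_eq_H_iff: "{u, v} \<in> E \<Longrightarrow> coord_hyperplane u v = H \<longleftrightarrow> {u, v} = {i, j}"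
  unfolding H by (intro coord_hyperplane_eq_iff edge_neq edge)

lemma \<alpha>_coeffs:
  assumes "{u, v} \<in> E"
  obtains c where "c \<noteq> 0"
    "\<And>k. \<alpha> (coord_hyperplane u v) $ k = (if k = u then c else if k = v then - c else 0)"
proof -
  have "defining_form UNIV (coord_hyperplane u v) (\<alpha> (coord_hyperplane u v))"
    using assms \<alpha>[of "coord_hyperplane u v"] A_iff by auto
  then have D: "defining_form {x. \<forall>k. x $ id k = x $ k} {x. (\<forall>k. x $ id k = x $ k) \<and> x $ u = x $ v}
      (\<alpha> (coord_hyperplane u v))"
    by (simp add: coord_hyperplane_def)
  obtain c where "c \<noteq> 0" "\<And>p. (\<Sum>k | id k = p. \<alpha> (coord_hyperplane u v) $ k)
      = (if p = id u then c else if p = id v then - c else 0)"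
    by (rule defining_form_coeffs[OF _ D]) (simp, blast)
  then show ?thesis using that by simp
qed

lemma form_\<alpha>:
  assumes "{u, v} \<in> E"
  obtains c where "c \<noteq> 0" "form_poly (\<alpha> (coord_hyperplane u v)) = pconst c * lin u v"
proof -
  obtain c where c: "c \<noteq> 0"
    "\<And>k. \<alpha> (coord_hyperplane u v) $ k = (if k = u then c else if k = v then - c else 0)"
    using \<alpha>_coeffs assms by blast
  then show ?thesis
    using that rename_form_poly[where s = id and a = "\<alpha> (coord_hyperplane u v)" and u = u and v = v and c = c]
      edge_neq[OF assms] by (simp add: rename_id)
qed

lemma restriction_memI:
  assumes "{u, v} \<in> E" "{u, v} \<noteq> {i, j}"
  shows "H \<inter> coord_hyperplane u v \<in> restriction A H"
  using assms hyperplane_eq_H_iff[of u v] A_iff[of "coord_hyperplane u v"]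
  by (auto simp: restriction_def)

text \<open>A form cutting out a hyperplane of H is determined only up to a constant factor and a
  multiple of x_i - x_j, so it is described after setting x_j = x_i.\<close>

lemma form_\<beta>:
  assumes "{u, v} \<in> E" "{u, v} \<noteq> {i, j}"
  obtains c where "c \<noteq> 0"
    "rename s (form_poly (\<beta> (H \<inter> coord_hyperplane u v))) = pconst c * lin (s u) (s v)"
    "s u \<noteq> s v"
proof -
  let ?Y = "H \<inter> coord_hyperplane u v"
  have "?Y \<in> restriction A H"
    using assms by (rule restriction_memI)
  moreover have H_eq: "H = {x. \<forall>k. x $ s k = x $ k}"
    by (auto simp: H coord_hyperplane_def collapse_def)
  ultimately have "defining_form {x. \<forall>k. x $ s k = x $ k} {x. (\<forall>k. x $ s k = x $ k) \<and> x $ u = x $ v} (\<beta> ?Y)"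
    using \<beta>[of ?Y] by (simp add: coord_hyperplane_def Collect_conj_eq)
  moreover have "s (s k) = s k" for k by (simp add: collapse_def)
  ultimately obtain c where "c \<noteq> 0"
    "\<And>p. (\<Sum>k | s k = p. \<beta> ?Y $ k) = (if p = s u then c else if p = s v then - c else 0)"
    using defining_form_coeffs by blast
  moreover have "s u \<noteq> s v"
    using assms edge_neq[OF assms(1)] by (auto simp: collapse_def insert_commute)
  ultimately show ?thesis using that rename_form_poly by blast
qed

lemma Q_nonzero: "Q \<noteq> 0"
proof -
  have "form_poly (\<alpha> L) \<noteq> 0" if "L \<in> A" for L
  proof -
    obtain u v where "{u, v} \<in> E" "L = coord_hyperplane u v" using \<open>L \<in> A\<close> A_iff by blast
    moreover obtain c where "c \<noteq> 0" "form_poly (\<alpha> (coord_hyperplane u v)) = pconst c * lin u v"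
      using form_\<alpha>[OF \<open>{u, v} \<in> E\<close>] by blast
    ultimately show ?thesis using edge_neq[of u v] by simp
  qed
  then show ?thesis using finite_A by (simp add: Q_poly_def)
qed

lemma restriction_cases:
  assumes "Y \<in> restriction A H"
  obtains u v where "{u, v} \<in> E" "{u, v} \<noteq> {i, j}" "Y = H \<inter> coord_hyperplane u v"
proof -
  obtain L where "L \<in> A" "L \<noteq> H" and Y: "Y = H \<inter> L"
    using assms by (auto simp: restriction_def)
  moreover from \<open>L \<in> A\<close> obtain u v where "{u, v} \<in> E" "L = coord_hyperplane u v"
    using A_iff by auto
  ultimately show ?thesis using that[of u v] hyperplane_eq_H_iff[of u v] by simp
qed

lemma finite_restriction: "finite (restriction A H)"
proof -
  have "restriction A H \<subseteq> (\<inter>) H ` A" by (auto simp: restriction_def)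
  then show ?thesis using finite_A finite_surj by blast
qed

lemma P_nonzero: "rename s P \<noteq> 0"
proof -
  have "rename s (form_poly (\<beta> Y)) \<noteq> 0" if "Y \<in> restriction A H" for Y
  proof -
    obtain u v where uv: "{u, v} \<in> E" "{u, v} \<noteq> {i, j}" and Y: "Y = H \<inter> coord_hyperplane u v"
      using \<open>Y \<in> restriction A H\<close> by (rule restriction_cases)
    from uv obtain c where "c \<noteq> 0" "s u \<noteq> s v"
      "rename s (form_poly (\<beta> (H \<inter> coord_hyperplane u v))) = pconst c * lin (s u) (s v)"
      by (rule form_\<beta>)
    then show ?thesis by (simp add: Y)
  qed
  then show ?thesis using finite_restriction by (simp add: P_def)
qed

section \<open>The logarithmic condition by components, and the value of the residue\<close>

definition is_log :: "(('n, 'k) mpoly, 'n) vec \<Rightarrow> bool"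
  where "is_log \<eta> \<longleftrightarrow> (\<forall>u v. {u, v} \<in> E \<longrightarrow>
    (\<forall>p. p \<noteq> u \<longrightarrow> p \<noteq> v \<longrightarrow> lin u v dvd \<eta> $ p) \<and> lin u v dvd \<eta> $ u + \<eta> $ v)"

lemma log_forms_eq:
  "log_forms A \<alpha> = (\<lambda>\<eta>. inverse (to_fract Q) *s fract_form \<eta>) ` {\<eta>. is_log \<eta>}"
proof -
  have wedge_iff: "(\<exists>\<theta>\<in>two_forms. wedge \<eta> (d_form (\<alpha> (coord_hyperplane u v))) =
        (\<chi> p q. form_poly (\<alpha> (coord_hyperplane u v)) * \<theta> $ p $ q)) \<longleftrightarrow>
      (\<forall>p. p \<noteq> u \<longrightarrow> p \<noteq> v \<longrightarrow> lin u v dvd \<eta> $ p) \<and> lin u v dvd \<eta> $ u + \<eta> $ v"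
    if uv: "{u, v} \<in> E" for u v and \<eta> :: "(('n, 'k) mpoly, 'n) vec"
  proof -
    obtain c where "c \<noteq> 0"
      "\<And>k. \<alpha> (coord_hyperplane u v) $ k = (if k = u then c else if k = v then - c else 0)"
      using \<alpha>_coeffs[OF uv] by blast
    then show ?thesis by (intro wedge_dvd_iff edge_neq uv)
  qed
  have all_A: "(\<forall>L\<in>A. C L) \<longleftrightarrow> (\<forall>u v. {u, v} \<in> E \<longrightarrow> C (coord_hyperplane u v))" for C
    unfolding A graphic_arrangement_def by blast
  have "(\<forall>L\<in>A. \<exists>\<theta>\<in>two_forms.
        wedge \<eta> (d_form (\<alpha> L)) = (\<chi> p q. form_poly (\<alpha> L) * \<theta> $ p $ q)) \<longleftrightarrow> is_log \<eta>" for \<eta>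
    unfolding is_log_def all_A by (intro iff_allI imp_cong refl wedge_iff)
  then show ?thesis by (auto simp: log_forms_def)
qed

lemma quot_class_H_eq_iff:
  "quot_class (\<alpha> H) f = quot_class (\<alpha> H) g \<longleftrightarrow> rename s f = rename s g"
proof -
  obtain c where "c \<noteq> 0" "form_poly (\<alpha> H) = pconst c * lin i j"
    using form_\<alpha>[OF edge] H by metis
  then have "quot_class (\<alpha> H) f = quot_class (\<alpha> H) g \<longleftrightarrow> lin i j dvd f - g"
    by (simp add: quot_class_eq_iff pconst_mult_dvd_iff)
  also have "\<dots> \<longleftrightarrow> lin j i dvd f - g" by (rule lin_dvd_swap)
  finally show ?thesis by (simp add: lin_dvd_iff)
qed

text \<open>The condition at the edge {i, j} itself: along H, \<eta> reduces to a multiple of dx_i -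
  dx_j.\<close>

lemma rename_log:
  assumes "is_log \<eta>"
  shows "rename s (\<eta> $ j) = - rename s (\<eta> $ i)"
    and "p \<noteq> i \<Longrightarrow> p \<noteq> j \<Longrightarrow> rename s (\<eta> $ p) = 0"
proof -
  have "lin i j dvd \<eta> $ i + \<eta> $ j" and p: "p \<noteq> i \<Longrightarrow> p \<noteq> j \<Longrightarrow> lin i j dvd \<eta> $ p"
    using assms edge by (auto simp: is_log_def)
  then have "lin j i dvd \<eta> $ i + \<eta> $ j" by (subst lin_dvd_swap)
  then show "rename s (\<eta> $ j) = - rename s (\<eta> $ i)"
    by (simp add: lin_dvd_iff eq_neg_iff_add_eq_0 add.commute)
  show "rename s (\<eta> $ p) = 0" if "p \<noteq> i" "p \<noteq> j"
    using p[OF that] by (subst (asm) lin_dvd_swap) (simp add: lin_dvd_iff)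
qed

text \<open>The residue is a definite description over all bases containing the form of H. One
  explicit basis gives existence; for uniqueness the coefficient is extracted from an arbitrary
  basis by a dual vector, and Q(A^H) is cancelled in the domain.\<close>

lemma residue_eq:
  assumes \<eta>: "is_log \<eta>" and \<rho>: "rename s (P * \<rho>) = rename s (pconst (inverse (\<alpha> H $ i)) * \<eta> $ i)"
  shows "residue A \<alpha> H \<beta> (inverse (to_fract Q) *s fract_form \<eta>) = quot_class (\<alpha> H) \<rho>"
proof -
  obtain c where c: "c \<noteq> 0" "\<And>k. \<alpha> H $ k = (if k = i then c else if k = j then - c else 0)"
    using \<alpha>_coeffs[OF edge] H by metis
  then have ci: "\<alpha> H $ i = c" by simp
  let ?R = "quot_ring (\<alpha> H)" and ?\<omega> = "inverse (to_fract Q) *s fract_form \<eta>"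
  have Q_restr: "Q_restr A \<alpha> H \<beta> = quot_class (\<alpha> H) P"
    by (simp add: Q_restr_def P_def quot_class_prod)
  show ?thesis
    unfolding residue_def Q_restr
  proof (rule the_equality, goal_cases)
    case 1
    let ?b = "\<lambda>p. if p = i then \<alpha> H else axis p 1"
    \<comment> \<open>With \<alpha>_H = c (x_i - x_j), substitute dx_i = d\<alpha>_H / c + dx_j: the
      coefficient of dx_j becomes the sum of those at i and j.\<close>
    let ?f = "\<lambda>p. if p = i then inverse (to_fract (pconst c)) * ?\<omega> $ i
      else if p = j then ?\<omega> $ i + ?\<omega> $ j else ?\<omega> $ p"
    let ?g = "pconst (inverse c) * \<eta> $ i"
    have inv: "to_fract (pconst (inverse c) :: ('n, 'k) mpoly) = inverse (to_fract (pconst c))"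
    proof -
      have "to_fract (pconst c) * to_fract (pconst (inverse c) :: ('n, 'k) mpoly) = 1"
        using pconst_inverse[OF c(1)] by (metis to_fract_1 to_fract_mult)
      then show ?thesis by (metis inverse_unique)
    qed
    have b: "form_basis ?b"
      by (rule form_basis_exchange) (simp add: c)
    have \<omega>: "?\<omega> = (\<Sum>p\<in>UNIV. ?f p *s fract_form (d_form (?b p)))"
    proof (subst vec_eq_iff, rule allI)
      fix k
      have "(\<Sum>p\<in>UNIV. ?f p *s fract_form (d_form (?b p))) $ k
          = ?f i * to_fract (pconst (\<alpha> H $ k)) + (\<Sum>p\<in>UNIV - {i}. ?f p * to_fract (pconst (axis p 1 $ k)))"
        by (simp add: sum.remove[of UNIV i] fract_form_def d_form_def)
      also have "(\<Sum>p\<in>UNIV - {i}. ?f p * to_fract (pconst (axis p 1 $ k)))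
          = (\<Sum>p\<in>UNIV - {i}. if p = k then ?f k else 0)"
        by (intro sum.cong) (auto simp: axis_def)
      also have "?f i * to_fract (pconst (\<alpha> H $ k)) + \<dots> = ?\<omega> $ k"
        using c i_neq_j by (auto simp: pconst_uminus)
      finally show "?\<omega> $ k = (\<Sum>p\<in>UNIV. ?f p *s fract_form (d_form (?b p))) $ k" by simp
    qed
    have g: "to_fract ?g = to_fract Q * ?f i"
      using Q_nonzero by (simp add: inv fract_form_def)
    have eq: "quot_class (\<alpha> H) P \<otimes>\<^bsub>?R\<^esub> quot_class (\<alpha> H) \<rho> = quot_class (\<alpha> H) ?g"
      using \<rho> ci by (simp only: quot_class_H_eq_iff flip: quot_class_mult)
    have h: "?b i = \<alpha> H" by simp
    show ?case
      by (rule conjI, simp add: carrier_quot_ring)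
        (rule exI[of _ ?b], rule exI[of _ i], rule exI[of _ ?f], rule exI[of _ ?g], intro conjI b h \<omega> g eq)
  next
    case (2 r)
    then obtain b h f g \<rho>' where r: "r = quot_class (\<alpha> H) \<rho>'" and b: "form_basis b" "b h = \<alpha> H"
      and \<omega>: "?\<omega> = (\<Sum>p\<in>UNIV. f p *s fract_form (d_form (b p)))"
      and g: "to_fract g = to_fract Q * f h"
      and eq: "quot_class (\<alpha> H) P \<otimes>\<^bsub>?R\<^esub> r = quot_class (\<alpha> H) g"
      unfolding carrier_quot_ring by (elim conjE exE imageE) (rule that; assumption)
    \<comment> \<open>Pairing with the dual vector w expresses the coefficient at h through the
      standard components of the form.\<close>
    obtain w where w: "\<And>p. scalar_product (b p) w = (if p = h then 1 else 0)"
      using form_basis_dual_vector[OF b(1)] by metis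
    have pconst_sum: "to_fract (pconst (sum F T)) = (\<Sum>k\<in>T. to_fract (pconst (F k) :: ('n, 'k) mpoly))"
      for F and T :: "'n set"
      by (induction T rule: infinite_finite_induct) (auto simp: pconst_add)
    have "(\<Sum>k\<in>UNIV. ?\<omega> $ k * to_fract (pconst (w $ k)))
        = (\<Sum>p\<in>UNIV. f p * (\<Sum>k\<in>UNIV. to_fract (pconst (b p $ k * w $ k))))"
      by (subst \<omega>, simp add: fract_form_def d_form_def sum_distrib_right sum_distrib_left pconst_mult,
        subst sum.swap, simp add: mult.assoc)
    also have "\<dots> = (\<Sum>p\<in>UNIV. f p * to_fract (pconst (scalar_product (b p) w)))"
      by (simp add: pconst_sum scalar_product_def)
    also have "\<dots> = (\<Sum>p\<in>UNIV. if p = h then f h else 0)"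
      by (intro sum.cong) (auto simp: w)
    finally have "f h = (\<Sum>k\<in>UNIV. ?\<omega> $ k * to_fract (pconst (w $ k)))" by simp
    then have "to_fract g = (\<Sum>k\<in>UNIV. to_fract (\<eta> $ k * pconst (w $ k)))"
      using Q_nonzero by (simp add: g sum_distrib_left fract_form_def flip: mult.assoc)
    also have "\<dots> = to_fract (\<Sum>k\<in>UNIV. \<eta> $ k * pconst (w $ k))"
      by (induction "UNIV :: 'n set" rule: infinite_finite_induct) auto
    finally have "g = (\<Sum>k\<in>UNIV. \<eta> $ k * pconst (w $ k))" by (simp only: to_fract_eq_iff)
    then have "rename s g = (\<Sum>k\<in>UNIV. rename s (\<eta> $ k) * pconst (w $ k))" by simp
    \<comment> \<open>Along H only the components at i and j survive, and they are opposite.\<close>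
    also have "\<dots> = (\<Sum>k\<in>UNIV. (if k = i then rename s (\<eta> $ i) * pconst (w $ i) else 0)
        + (if k = j then - rename s (\<eta> $ i) * pconst (w $ j) else 0))"
      using i_neq_j by (intro sum.cong) (auto simp: rename_log[OF \<eta>])
    also have "\<dots> = rename s (\<eta> $ i) * pconst (w $ i - w $ j)"
      by (simp add: sum.distrib pconst_diff algebra_simps)
    \<comment> \<open>The form \<alpha>_H = c (x_i - x_j) takes the value 1 at w.\<close>
    also have "w $ i - w $ j = inverse c"
    proof -
      have "(\<Sum>k\<in>UNIV. (if k = i then c * w $ i else 0) + (if k = j then - c * w $ j else 0))
          = scalar_product (b h) w"
        unfolding b(2) scalar_product_def using i_neq_j by (intro sum.cong) (auto simp: c)
      then have "c * (w $ i - w $ j) = 1"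
        by (simp add: w sum.distrib algebra_simps)
      then show ?thesis by (metis inverse_unique)
    qed
    finally have "rename s g = rename s (pconst (inverse c) * \<eta> $ i)"
      by (simp add: mult.commute)
    then have "rename s g = rename s (P * \<rho>)" by (simp only: \<rho> ci)
    moreover have "rename s g = rename s (P * \<rho>')"
      using eq by (simp only: r quot_class_H_eq_iff flip: quot_class_mult)
    ultimately have "rename s P * rename s \<rho>' = rename s P * rename s \<rho>" by simp
    then show ?case
      using P_nonzero by (simp add: r quot_class_H_eq_iff)
  qed
qed

text \<open>Lifts of residues with the constant factor 1/c omitted; rescaling the logarithmic form
  absorbs it.\<close>

definition residue_reps :: "('n, 'k) mpoly set"
  where "residue_reps = {\<rho>. \<exists>\<eta>. is_log \<eta> \<and> rename s (P * \<rho>) = rename s (\<eta> $ i)}"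

lemma is_log_add: "is_log \<eta> \<Longrightarrow> is_log \<eta>' \<Longrightarrow> is_log (\<eta> + \<eta>')"
proof -
  assume "is_log \<eta>" "is_log \<eta>'"
  moreover have "(\<eta> + \<eta>') $ u + (\<eta> + \<eta>') $ v = (\<eta> $ u + \<eta> $ v) + (\<eta>' $ u + \<eta>' $ v)" for u v
    by simp
  ultimately show ?thesis
    unfolding is_log_def by (simp only: vector_add_component) (blast intro: dvd_add)
qed

lemma is_log_mult:
  assumes "is_log \<eta>" shows "is_log (t *s \<eta>)"
  using assms unfolding is_log_def by (auto simp flip: distrib_left)

lemma rename_s_idem [simp]: "rename (s \<circ> s) p = rename s p"
proof -
  have "s \<circ> s = s" by (auto simp: collapse_def)
  then show ?thesis by simp
qed

lemma residue_reps_add: "p \<in> residue_reps \<Longrightarrow> q \<in> residue_reps \<Longrightarrow> p + q \<in> residue_reps"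
  unfolding residue_reps_def
proof clarify
  fix \<eta> \<eta>' assume "is_log \<eta>" "is_log \<eta>'"
    "rename s (P * p) = rename s (\<eta> $ i)" "rename s (P * q) = rename s (\<eta>' $ i)"
  then have "is_log (\<eta> + \<eta>')" "rename s (P * (p + q)) = rename s ((\<eta> + \<eta>') $ i)"
    by (auto simp: is_log_add distrib_left)
  then show "\<exists>\<eta>. is_log \<eta> \<and> rename s (P * (p + q)) = rename s (\<eta> $ i)" by blast
qed

lemma residue_reps_mult: "q \<in> residue_reps \<Longrightarrow> p * q \<in> residue_reps"
  unfolding residue_reps_def
proof clarify
  fix \<eta> assume \<eta>: "is_log \<eta>" and q: "rename s (P * q) = rename s (\<eta> $ i)"
  have "rename s (P * (p * q)) = rename s p * rename s (P * q)" by (simp add: ac_simps)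
  also have "\<dots> = rename s ((p *s \<eta>) $ i)" by (subst q) simp
  finally show "\<exists>\<eta>. is_log \<eta> \<and> rename s (P * (p * q)) = rename s (\<eta> $ i)"
    using is_log_mult[OF \<eta>] by blast
qed

section \<open>Traces on H and divisibility by Q(A^H)\<close>

lemma restriction_eqD:
  assumes "{u, v} \<in> E" "{u, v} \<noteq> {i, j}" "{u', v'} \<in> E" "{u', v'} \<noteq> {i, j}"
    and "H \<inter> coord_hyperplane u v = H \<inter> coord_hyperplane u' v'"
  shows "{s u, s v} = {s u', s v'}"
proof -
  obtain c where c: "c \<noteq> 0" "s u \<noteq> s v"
    "rename s (form_poly (\<beta> (H \<inter> coord_hyperplane u v))) = pconst c * lin (s u) (s v)"
    using form_\<beta>[OF assms(1,2)] by blast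
  obtain c' where c': "c' \<noteq> 0" "s u' \<noteq> s v'"
    "rename s (form_poly (\<beta> (H \<inter> coord_hyperplane u' v'))) = pconst c' * lin (s u') (s v')"
    using form_\<beta>[OF assms(3,4)] by blast
  \<comment> \<open>Equal traces have the same \<beta>, so the two restricted linear forms are
    proportional.\<close>
  have "lin (s u) (s v) dvd (pconst c' * lin (s u') (s v') :: ('n, 'k) mpoly)"
    using c(3) c'(3) assms(5) by (metis dvd_triv_right)
  then have "lin (s u) (s v) dvd (lin (s u') (s v') :: ('n, 'k) mpoly)"
    using c' by (simp add: lin_dvd_iff)
  then show ?thesis by (simp only: lin_dvd_lin_iff[OF c(2) c'(2)])
qed

lemma H_Int_hyperplane: "H \<inter> coord_hyperplane u v = H \<inter> coord_hyperplane (s u) (s v)"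
  by (auto simp: H coord_hyperplane_def collapse_def)

text \<open>This is why residues are polynomial: along H every factor of Q(A^H) divides \<eta>_i,
  and distinct hyperplanes of H give non-associated primes.\<close>

lemma residue_rep_exists:
  assumes \<eta>: "is_log \<eta>"
  obtains \<rho> where "rename s (P * \<rho>) = rename s (\<eta> $ i)"
proof -
  let ?B = "\<lambda>Y. rename s (form_poly (\<beta> Y))"
  have "prod ?B (restriction A H) dvd rename s (\<eta> $ i)"
  proof (rule prod_primes_dvd[OF finite_restriction])
    fix Y assume "Y \<in> restriction A H"
    then obtain u v where uv: "{u, v} \<in> E" "{u, v} \<noteq> {i, j}" and Y: "Y = H \<inter> coord_hyperplane u v"
      by (rule restriction_cases)
    from uv obtain c where c: "c \<noteq> 0" "s u \<noteq> s v"
      and B: "rename s (form_poly (\<beta> (H \<inter> coord_hyperplane u v))) = pconst c * lin (s u) (s v)"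
      by (rule form_\<beta>)
    show "prime_elem (?B Y)"
      unfolding Y B using c by (rule prime_elem_scaled_lin)
    have "rename s (lin u v) dvd rename s (\<eta> $ i)"
    proof (cases "i \<in> {u, v}")
      case False
      then have "lin u v dvd \<eta> $ i" using \<eta> uv by (auto simp: is_log_def)
      then show ?thesis by (rule rename_dvd)
    next
      \<comment> \<open>An edge through i other than {i, j} misses j, so its form divides \<eta>_j,
        which equals -\<eta>_i along H.\<close>
      case True
      then have "j \<noteq> u" "j \<noteq> v" using uv(2) i_neq_j by auto
      then have "lin u v dvd \<eta> $ j" using \<eta> uv by (auto simp: is_log_def)
      then have "rename s (lin u v) dvd rename s (\<eta> $ j)" by (rule rename_dvd)
      then show ?thesis using rename_log(1)[OF \<eta>] by simp
    qed
    then show "?B Y dvd rename s (\<eta> $ i)"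
      unfolding Y B using c by (simp add: pconst_mult_dvd_iff)
    fix Y' assume "Y' \<in> restriction A H"
    then obtain u' v' where uv': "{u', v'} \<in> E" "{u', v'} \<noteq> {i, j}"
      and Y': "Y' = H \<inter> coord_hyperplane u' v'"
      by (rule restriction_cases)
    from uv' obtain c' where c': "c' \<noteq> 0" "s u' \<noteq> s v'"
      and B': "rename s (form_poly (\<beta> (H \<inter> coord_hyperplane u' v'))) = pconst c' * lin (s u') (s v')"
      by (rule form_\<beta>)
    assume "Y \<noteq> Y'"
    show "\<not> ?B Y dvd ?B Y'"
    proof
      assume "?B Y dvd ?B Y'"
      then have "lin (s u) (s v) dvd (lin (s u') (s v') :: ('n, 'k) mpoly)"
        unfolding Y Y' B B' using c c' by (simp add: pconst_mult_dvd_iff) (simp add: lin_dvd_iff)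
      then have "{s u, s v} = {s u', s v'}" by (simp only: lin_dvd_lin_iff[OF c(2) c'(2)])
      then have "coord_hyperplane (s u) (s v) = (coord_hyperplane (s u') (s v') :: ('n, 'k) space set)"
        by (simp only: coord_hyperplane_eq_iff[OF c(2) c'(2)])
      then show False using \<open>Y \<noteq> Y'\<close> Y Y' H_Int_hyperplane by metis
    qed
  qed
  \<comment> \<open>The quotient q may involve x_j; a second, idempotent application of
    \<open>rename s\<close> makes it usable as a representative.\<close>
  then obtain q where "rename s (\<eta> $ i) = rename s P * q" by (auto simp: P_def elim: dvdE)
  then have "rename s (rename s (\<eta> $ i)) = rename s (rename s P * q)" by (rule arg_cong)
  then show ?thesis using that[of q] by simp
qed

section \<open>Residues lie in every ideal (y_u, y_v) with u, v not adjacent\<close>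

lemma W_neq:
  assumes "u \<in> W" shows "u \<noteq> i" "u \<noteq> j"
  using assms edge_neq[of u i] edge_neq[of u j] by (auto simp: W)

text \<open>Two factors of Q(A^H), namely y_u and y_v, cancel against \<eta>_i and leave a cofactor
  in (y_u, y_v). Non-adjacency enters through the remaining factors: an edge {u, v} would contribute
  one more factor in this prime ideal.\<close>

lemma residue_rep_vanishes:
  assumes \<eta>: "is_log \<eta>" and \<rho>: "rename s (P * \<rho>) = rename s (\<eta> $ i)"
    and u: "u \<in> W" and v: "v \<in> W" and uv: "u \<noteq> v" "{u, v} \<notin> E"
  shows "rename (collapse {u, v, j} i) \<rho> = 0"
proof -
  note neq = W_neq[OF u] W_neq[OF v] i_neq_j uv(1)
  have edges: "{u, i} \<in> E" "{u, j} \<in> E" "{v, i} \<in> E" "{v, j} \<in> E" "{i, j} \<in> E"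
    using u v edge by (auto simp: W)
  have off: "lin p q dvd \<eta> $ r" if "{p, q} \<in> E" "r \<noteq> p" "r \<noteq> q" for p q r
    using \<eta> that by (auto simp: is_log_def)
  let ?t = "collapse {u} i" and ?p = "collapse {u, v, j} i"
  \<comment> \<open>Vertex i lies off the edges {u, j} and {v, j}; below, u lies off {i, j}, {v, i}
    and {v, j}.\<close>
  have "lin u j * lin v j dvd \<eta> $ i"
    using edges neq
    by (intro prime_elem_mult_dvd prime_elem_lin off) (auto simp: lin_dvd_lin_iff doubleton_eq_iff)
  then obtain a where a: "\<eta> $ i = lin u j * lin v j * a" ..
  have "lin i j * lin v i * lin v j dvd \<eta> $ u"
    using edges neq
    by (intro prime_elem_mult_dvd prime_elem_lin off)
      (auto simp: lin_dvd_lin_iff doubleton_eq_iff prime_elem_dvd_mult_iff[OF prime_elem_lin])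
  then obtain c where c: "\<eta> $ u = lin i j * lin v i * lin v j * c" ..
  have "lin u i dvd \<eta> $ u + \<eta> $ i" using \<eta> edges by (auto simp: is_log_def)
  then have "rename ?t (\<eta> $ u + \<eta> $ i) = 0" by (simp add: lin_dvd_iff)
  \<comment> \<open>Setting x_u = x_i turns x_u - x_j into x_i - x_j, so both summands share the
    displayed factor. After cancelling it, the image of a is a multiple of x_v - x_i.\<close>
  then have "lin i j * lin v j * (rename ?t a + lin v i * rename ?t c) = 0"
    using neq by (simp add: a c collapse_def algebra_simps)
  then have "rename ?t a = - (lin v i * rename ?t c)"
    using neq by (simp add: eq_neg_iff_add_eq_0)
  moreover have pt: "?p \<circ> ?t = ?p" and ps: "?p \<circ> s = ?p" by (auto simp: collapse_def)
  moreover have "?p v = ?p i" by (simp add: collapse_def)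
  moreover have "rename ?p a = rename ?p (rename ?t a)" by (simp only: rename_rename pt)
  ultimately have pa: "rename ?p a = 0" by simp
  define Y1 where "Y1 = H \<inter> coord_hyperplane u i"
  define Y2 where "Y2 = H \<inter> coord_hyperplane v i"
  have ne: "{u, i} \<noteq> {i, j}" "{v, i} \<noteq> {i, j}" using neq by (auto simp: doubleton_eq_iff)
  have "Y1 \<in> restriction A H" "Y2 \<in> restriction A H"
    unfolding Y1_def Y2_def using edges ne by (auto intro: restriction_memI)
  moreover have "Y1 \<noteq> Y2"
    using restriction_eqD[OF edges(1) ne(1) edges(3) ne(2)] neq
    by (auto simp: Y1_def Y2_def collapse_def doubleton_eq_iff)
  moreover define R where "R = (\<Prod>Y\<in>restriction A H - {Y1} - {Y2}. form_poly (\<beta> Y))"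
  ultimately have P_eq: "P = form_poly (\<beta> Y1) * (form_poly (\<beta> Y2) * R)"
    unfolding P_def using finite_restriction by (simp add: prod.remove[of _ Y1] prod.remove[of _ Y2])
  have "rename ?p R \<noteq> 0"
  proof -
    have "rename ?p (form_poly (\<beta> Y)) \<noteq> 0" if Y: "Y \<in> restriction A H - {Y1} - {Y2}" for Y
    proof -
      have "Y \<in> restriction A H" using Y by simp
      then obtain p q where pq: "{p, q} \<in> E" "{p, q} \<noteq> {i, j}" and Y_eq: "Y = H \<inter> coord_hyperplane p q"
        by (rule restriction_cases)
      from pq obtain d where d: "d \<noteq> 0"
        "rename s (form_poly (\<beta> (H \<inter> coord_hyperplane p q))) = pconst d * lin (s p) (s q)" "s p \<noteq> s q"
        by (rule form_\<beta>)
      have "rename ?p (form_poly (\<beta> Y)) = rename ?p (rename s (form_poly (\<beta> Y)))"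
        using ps by simp
      also have "\<dots> = pconst d * lin (?p p) (?p q)"
        unfolding Y_eq d(2) using ps by (simp add: fun_eq_iff)
      also have "\<dots> \<noteq> 0"
      proof -
        have "?p p \<noteq> ?p q"
        proof
          assume "?p p = ?p q"
          \<comment> \<open>After setting x_j = x_i, an edge killed by the further substitution has
            both ends in {u, v, i}, and {u, v} is excluded.\<close>
          then have "{s p, s q} = {u, i} \<or> {s p, s q} = {v, i}"
            using pq uv d(3) edge_neq[OF pq(1)] neq
            by (auto simp: collapse_def doubleton_eq_iff insert_commute split: if_splits)
          then have "coord_hyperplane (s p) (s q) = (coord_hyperplane u i :: ('n, 'k) space set)
              \<or> coord_hyperplane (s p) (s q) = (coord_hyperplane v i :: ('n, 'k) space set)"
            by (simp only: coord_hyperplane_eq_iff[OF d(3) neq(1)] coord_hyperplane_eq_iff[OF d(3) neq(3)])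
          then have "Y = Y1 \<or> Y = Y2"
            unfolding Y_eq Y1_def Y2_def H_Int_hyperplane[of p q] by metis
          then show False using Y by simp
        qed
        then show ?thesis using d by simp
      qed
      finally show ?thesis .
    qed
    then show ?thesis using finite_restriction by (simp add: R_def)
  qed
  obtain c1 where c1: "c1 \<noteq> 0" "rename s (form_poly (\<beta> Y1)) = pconst c1 * lin (s u) (s i)"
    unfolding Y1_def using form_\<beta>[OF edges(1) ne(1)] by blast
  obtain c2 where c2: "c2 \<noteq> 0" "rename s (form_poly (\<beta> Y2)) = pconst c2 * lin (s v) (s i)"
    unfolding Y2_def using form_\<beta>[OF edges(3) ne(2)] by blast
  have s: "s u = u" "s v = v" "s i = i" "s j = i" using neq by (auto simp: collapse_def)
  \<comment> \<open>On H the factors x_u - x_j and x_v - x_j of \<eta>_i become y_u and y_v,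
    matching the two factors split off P.\<close>
  have "lin u i * lin v i * (pconst c1 * pconst c2 * rename s R * rename s \<rho>) = rename s (P * \<rho>)"
    by (simp add: P_eq c1 c2 s ac_simps)
  also have "\<dots> = lin u i * lin v i * rename s a"
    by (simp only: \<rho> a) (simp add: s)
  finally have "pconst c1 * pconst c2 * rename s R * rename s \<rho> = rename s a"
    using neq by simp
  then have "rename ?p (pconst c1 * pconst c2 * rename s R * rename s \<rho>) = rename ?p (rename s a)"
    by (rule arg_cong)
  then have "pconst c1 * pconst c2 * rename ?p R * rename ?p \<rho> = 0"
    using ps pa by simp
  then show ?thesis using c1(1) c2(1) \<open>rename ?p R \<noteq> 0\<close> by simp
qed

section \<open>Residues obtained from cliques\<close>

lemma form_\<alpha>_dvd_Q:
  assumes "{u, v} \<in> E" shows "lin u v dvd Q"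
proof -
  obtain c where "c \<noteq> 0" "form_poly (\<alpha> (coord_hyperplane u v)) = pconst c * lin u v"
    using form_\<alpha>[OF assms] by blast
  moreover have "form_poly (\<alpha> (coord_hyperplane u v)) dvd Q"
    unfolding Q_poly_def using finite_A A_iff assms by (intro dvd_prodI) auto
  ultimately show ?thesis by (simp add: pconst_mult_dvd_iff)
qed

lemma restrict_form_\<alpha>_dvd:
  assumes "L \<in> A - {H}"
  shows "rename s (form_poly (\<alpha> L)) dvd rename s (form_poly (\<beta> (H \<inter> L)))"
proof -
  obtain u v where uv: "{u, v} \<in> E" and L: "L = coord_hyperplane u v"
    using assms A_iff by blast
  then have ne: "{u, v} \<noteq> {i, j}" using assms hyperplane_eq_H_iff[OF uv] by simp
  obtain c where c: "c \<noteq> 0" "form_poly (\<alpha> (coord_hyperplane u v)) = pconst c * lin u v"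
    using form_\<alpha>[OF uv] by blast
  obtain d where d: "rename s (form_poly (\<beta> (H \<inter> coord_hyperplane u v))) = pconst d * lin (s u) (s v)"
    using form_\<beta>[OF uv ne] by blast
  show ?thesis
    unfolding L c(2) d
    by (simp only: rename_mult rename_pconst rename_lin pconst_mult_dvd_iff[OF c(1)] dvd_triv_right)
qed

text \<open>For k in W the hyperplanes x_k = x_i and x_k = x_j have the same trace; discarding the
  second leaves one hyperplane for each trace.\<close>

lemma inj_on_restrict:
  "inj_on (\<lambda>L. H \<inter> L) (A - {H} - (\<lambda>k. coord_hyperplane k j) ` W)"
proof (rule inj_onI)
  let ?T = "(\<lambda>k. coord_hyperplane k j) ` W :: ('n, 'k) space set set"
  fix L L' assume "L \<in> A - {H} - ?T" "L' \<in> A - {H} - ?T" and eq: "H \<inter> L = H \<inter> L'"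
  then obtain u v u' v' where uv: "{u, v} \<in> E" "L = coord_hyperplane u v"
    and uv': "{u', v'} \<in> E" "L' = coord_hyperplane u' v'"
    and "L \<noteq> H" "L' \<noteq> H" and LT: "L \<notin> ?T" "L' \<notin> ?T"
    using A_iff by (metis DiffE singletonI)
  then have ne: "{u, v} \<noteq> {i, j}" "{u', v'} \<noteq> {i, j}"
    using hyperplane_eq_H_iff by auto
  have comm: "coord_hyperplane p q = (coord_hyperplane q p :: ('n, 'k) space set)" for p q
    by (auto simp: coord_hyperplane_def)
  have T: "coord_hyperplane j k \<in> ?T" "coord_hyperplane k j \<in> ?T"
    if "{i, k} \<in> E" "{j, k} \<in> E" for k
  proof -
    have "k \<in> W" using that by (simp add: W insert_commute)
    then show "coord_hyperplane k j \<in> ?T" by (rule imageI)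
    then show "coord_hyperplane j k \<in> ?T" by (subst comm[of j k])
  qed
  have s: "{s u, s v} = {s u', s v'}"
    using restriction_eqD[OF uv(1) ne(1) uv'(1) ne(2)] eq uv(2) uv'(2) by simp
  have "{u, v} = {u', v'}"
  proof (rule ccontr)
    assume contr: "{u, v} \<noteq> {u', v'}"
    \<comment> \<open>Passing to s-images only forgets whether an end is i or j, so distinct edges
      with equal images are {i, k} and {j, k}.\<close>
    have "\<exists>k. {i, k} \<in> E \<and> {j, k} \<in> E \<and> ({u, v} = {j, k} \<or> {u', v'} = {j, k})"
      using s contr uv(1) uv'(1) ne edge_neq[OF uv(1)] edge_neq[OF uv'(1)]
      by (auto simp: collapse_def doubleton_eq_iff insert_commute split: if_splits)
    then show False
      using LT T uv(2) uv'(2) by (auto simp: doubleton_eq_iff)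
  qed
  then show "L = L'"
    using uv(2) uv'(2) comm by (auto simp: doubleton_eq_iff)
qed

text \<open>
  Two hyperplanes of \<open>A\<close> have the same trace on \<open>H\<close> only if they come from edges joining some
  \<open>k \<in> W\<close> to \<open>i\<close> and to \<open>j\<close>, which accounts for the extra factors over \<open>W\<close>.
\<close>

lemma restricted_Q_dvd:
  "rename s (\<Prod>L\<in>A - {H}. form_poly (\<alpha> L)) dvd rename s P * (\<Prod>k\<in>W. lin k i)"
proof -
  let ?f = "\<lambda>L. rename s (form_poly (\<alpha> L))" and ?B = "\<lambda>Y. rename s (form_poly (\<beta> Y))"
  let ?T = "(\<lambda>k. coord_hyperplane k j) ` W :: ('n, 'k) space set set"
  have WE: "{k, j} \<in> E" if "k \<in> W" for k using that by (simp add: W)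
  have T: "?T \<subseteq> A - {H}"
  proof (rule image_subsetI)
    fix k assume k: "k \<in> W"
    have "{k, j} \<noteq> {i, j}" using W_neq[OF k] by (auto simp: doubleton_eq_iff)
    then show "coord_hyperplane k j \<in> A - {H}"
      using hyperplane_eq_H_iff[OF WE[OF k]] WE[OF k] A_iff by blast
  qed
  \<comment> \<open>Outside \<open>?T\<close> the restricted forms match distinct factors of Q(A^H)
    up to constants.\<close>
  have "prod ?f (A - {H} - ?T) dvd (\<Prod>L\<in>A - {H} - ?T. ?B (H \<inter> L))"
    using restrict_form_\<alpha>_dvd by (intro prod_dvd_prod) auto
  also have "\<dots> = prod ?B ((\<lambda>L. H \<inter> L) ` (A - {H} - ?T))"
    using inj_on_restrict by (simp add: prod.reindex)
  also have "\<dots> dvd prod ?B (restriction A H)"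
    by (intro prod_dvd_prod_subset finite_restriction) (auto simp: restriction_def)
  finally have 1: "prod ?f (A - {H} - ?T) dvd rename s P" by (simp add: P_def)
  have "inj_on (\<lambda>k. coord_hyperplane k j :: ('n, 'k) space set) W"
    using W_neq by (auto simp: inj_on_def coord_hyperplane_eq_iff doubleton_eq_iff)
  then have "prod ?f ?T = (\<Prod>k\<in>W. ?f (coord_hyperplane k j))"
    by (simp add: prod.reindex)
  \<comment> \<open>On H the form x_k - x_j becomes x_k - x_i, the surplus factor for k.\<close>
  also have "\<dots> dvd (\<Prod>k\<in>W. lin k i)"
  proof (rule prod_dvd_prod)
    fix k assume k: "k \<in> W"
    obtain c where "c \<noteq> 0" "form_poly (\<alpha> (coord_hyperplane k j)) = pconst c * lin k j"
      using form_\<alpha>[OF WE[OF k]] by blast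
    then show "?f (coord_hyperplane k j) dvd lin k i"
      using W_neq[OF k] by (simp add: pconst_mult_dvd_iff collapse_def)
  qed
  finally have 2: "prod ?f ?T dvd (\<Prod>k\<in>W. lin k i)" .
  have "prod ?f (A - {H}) = prod ?f (A - {H} - ?T) * prod ?f ?T"
    using T finite_A by (simp add: prod.subset_diff)
  also have "\<dots> dvd rename s P * (\<Prod>k\<in>W. lin k i)"
    using 1 2 by (rule mult_dvd_mono)
  finally show ?thesis by simp
qed

text \<open>Here \<open>\<eta> / Q\<close> is the form \<open>\<Sum>p\<in>C. dx p / (\<Prod>q\<in>C - {p}. x q - x p)\<close>.\<close>

lemma clique_log_form:
  assumes clique: "\<And>p q. p \<in> C \<Longrightarrow> q \<in> C \<Longrightarrow> p \<noteq> q \<Longrightarrow> {p, q} \<in> E"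
  obtains \<eta> where "is_log \<eta>" "\<And>p. p \<in> C \<Longrightarrow> \<eta> $ p * (\<Prod>q\<in>C - {p}. lin q p) = Q"
proof -
  have "\<exists>g. g * (\<Prod>q\<in>C - {p}. lin q p) = Q" if "p \<in> C" for p
  proof -
    have "(\<Prod>q\<in>C - {p}. lin q p) dvd Q"
    proof (rule prod_primes_dvd)
      fix q assume "q \<in> C - {p}"
      then show "prime_elem (lin q p :: ('n, 'k) mpoly)" "lin q p dvd Q"
        using clique[of q p] that by (auto intro: prime_elem_lin form_\<alpha>_dvd_Q)
    next
      fix q q' assume "q \<in> C - {p}" "q' \<in> C - {p}" "q \<noteq> q'"
      then show "\<not> lin q p dvd (lin q' p :: ('n, 'k) mpoly)"
        by (subst lin_dvd_lin_iff) (auto simp: doubleton_eq_iff)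
    qed simp
    then show ?thesis by (metis dvdE mult.commute)
  qed
  then obtain g where g: "\<And>p. p \<in> C \<Longrightarrow> g p * (\<Prod>q\<in>C - {p}. lin q p) = Q" by metis
  define \<eta> :: "(('n, 'k) mpoly, 'n) vec" where "\<eta> = (\<chi> p. if p \<in> C then g p else 0)"
  \<comment> \<open>The substitution kills Q = g_p times the product, but not the product when no
    other clique vertex is identified with p; hence it kills g_p.\<close>
  have vanish: "rename (collapse {u} v) (\<eta> $ p) = 0"
    if uv: "{u, v} \<in> E" and t: "p \<in> C \<Longrightarrow> \<forall>q\<in>C - {p}. collapse {u} v q \<noteq> collapse {u} v p" for u v p
  proof (cases "p \<in> C")
    case True
    have "rename (collapse {u} v) Q = 0" using form_\<alpha>_dvd_Q[OF uv] by (simp add: lin_dvd_iff)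
    then have "rename (collapse {u} v) (g p) * (\<Prod>q\<in>C - {p}. lin (collapse {u} v q) (collapse {u} v p)) = 0"
      by (simp flip: g[OF True])
    then show ?thesis using t[OF True] True by (auto simp: \<eta>_def)
  qed (simp add: \<eta>_def)
  have "is_log \<eta>"
    unfolding is_log_def
  proof (intro allI impI conjI)
    fix u v p assume uv: "{u, v} \<in> E" and "p \<noteq> u" "p \<noteq> v"
    then show "lin u v dvd \<eta> $ p"
      unfolding lin_dvd_iff by (intro vanish[OF uv]) (auto simp: collapse_def)
  next
    fix u v assume uv: "{u, v} \<in> E"
    then have "u \<noteq> v" by (rule edge_neq)
    let ?t = "collapse {u} v"
    show "lin u v dvd \<eta> $ u + \<eta> $ v"
    proof (cases "u \<in> C \<and> v \<in> C")
      case False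
      \<comment> \<open>When the edge is not inside C, neither end is identified with another vertex
        of C, so both components vanish separately.\<close>
      then have "rename ?t (\<eta> $ u) = 0" "rename ?t (\<eta> $ v) = 0"
        by (intro vanish[OF uv]; auto simp: collapse_def)+
      then show ?thesis by (simp add: lin_dvd_iff)
    next
      case True
      obtain Q' where Q': "Q = lin u v * Q'" using form_\<alpha>_dvd_Q[OF uv] ..
      let ?D = "\<lambda>p. \<Prod>q\<in>C - {u, v}. lin q p :: ('n, 'k) mpoly"
      have "C - {u} = insert v (C - {u, v})" "C - {v} = insert u (C - {u, v})"
        using True \<open>u \<noteq> v\<close> by auto
      then have "(\<Prod>q\<in>C - {u}. lin q u) = lin v u * ?D u" "(\<Prod>q\<in>C - {v}. lin q v) = lin u v * ?D v"
        by simp_all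
      then have "g u * (lin v u * ?D u) = lin u v * Q'" "g v * (lin u v * ?D v) = lin u v * Q'"
        using g True Q' by metis+
      then have "lin u v * (- (g u * ?D u)) = lin u v * Q'" "lin u v * (g v * ?D v) = lin u v * Q'"
        by (simp_all add: lin_swap[of v u] ac_simps)
      then have "- (g u * ?D u) = Q'" "g v * ?D v = Q'"
        using \<open>u \<noteq> v\<close> by (simp_all only: mult_cancel_left lin_eq_0_iff simp_thms)
      then have "g u * ?D u + g v * ?D v = 0" by (metis add.right_inverse)
      then have "rename ?t (g u * ?D u + g v * ?D v) = 0" by (simp only: rename_0)
      \<comment> \<open>The two components times their remaining products cancel, because x_v - x_u
        and x_u - x_v have opposite signs; these products agree once x_u = x_v.\<close>
      moreover have "rename ?t (?D u) = ?D v" "rename ?t (?D v) = ?D v"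
        using \<open>u \<noteq> v\<close> by (auto simp: collapse_def intro!: prod.cong)
      ultimately have "(rename ?t (g u) + rename ?t (g v)) * ?D v = 0"
        by (simp only: rename_add rename_mult distrib_right)
      moreover have "?D v \<noteq> 0" by simp
      ultimately show ?thesis using True by (simp add: lin_dvd_iff \<eta>_def)
    qed
  qed
  then show ?thesis using that[of \<eta>] g by (simp add: \<eta>_def)
qed

text \<open>For the clique K with i and j added, removing the form of H from Q shows that along H,
  \<eta>_i times the y_k over K is a constant times the restricted remaining forms. These divide
  Q(A^H) times the y_k over W, and the factors over K cancel.\<close>

lemma clique_residue_reps:
  assumes "K \<subseteq> W" and clique: "\<And>u v. u \<in> K \<Longrightarrow> v \<in> K \<Longrightarrow> u \<noteq> v \<Longrightarrow> {u, v} \<in> E"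
  shows "(\<Prod>k\<in>W - K. lin k i) \<in> residue_reps"
proof -
  have K: "{k, i} \<in> E" "{k, j} \<in> E" "k \<noteq> i" "k \<noteq> j" if "k \<in> K" for k
    using assms(1) that W_neq[of k] by (auto simp: W)
  have fixed: "rename s (\<Prod>k\<in>T. lin k i) = (\<Prod>k\<in>T. lin k i :: ('n, 'k) mpoly)" if "T \<subseteq> W" for T
    using that W_neq by (auto simp: collapse_def intro!: prod.cong)
  have K': "{i, k} \<in> E" "{j, k} \<in> E" if "k \<in> K" for k
    using K(1,2)[OF that] by (simp_all add: insert_commute)
  obtain \<eta> where \<eta>: "is_log \<eta>"
    and Q: "\<And>p. p \<in> insert i (insert j K) \<Longrightarrow>
      \<eta> $ p * (\<Prod>q\<in>insert i (insert j K) - {p}. lin q p) = Q"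
  proof (rule clique_log_form[of "insert i (insert j K)"])
    fix p q assume "p \<in> insert i (insert j K)" "q \<in> insert i (insert j K)" "p \<noteq> q"
    then show "{p, q} \<in> E"
      using K(1,2) K' clique edge by (auto simp: insert_commute[of j i])
  qed blast
  have "insert i (insert j K) - {i} = insert j K" "j \<notin> K" using K i_neq_j by auto
  then have "\<eta> $ i * (lin j i * (\<Prod>k\<in>K. lin k i)) = Q" using Q[of i] by simp
  moreover have "H \<in> A" using edge H A_iff by blast
  moreover obtain c where c: "c \<noteq> 0" "form_poly (\<alpha> H) = pconst c * lin i j"
    using form_\<alpha>[OF edge] H by metis
  moreover define M where "M = (\<Prod>L\<in>A - {H}. form_poly (\<alpha> L))"
  ultimately have "lin i j * (- (\<eta> $ i * (\<Prod>k\<in>K. lin k i))) = lin i j * (pconst c * M)"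
    using finite_A by (simp add: Q_poly_def prod.remove[of A H] lin_swap[of j i] ac_simps)
  then have "- (\<eta> $ i * (\<Prod>k\<in>K. lin k i)) = pconst c * M"
    using i_neq_j by (simp only: mult_cancel_left lin_eq_0_iff simp_thms)
  then have "rename s (- (\<eta> $ i * (\<Prod>k\<in>K. lin k i))) = rename s (pconst c * M)" by (rule arg_cong)
  then have "pconst c * rename s M = - (rename s (\<eta> $ i) * (\<Prod>k\<in>K. lin k i))"
    by (simp only: rename_uminus rename_mult rename_pconst fixed[OF assms(1)])
  moreover have "pconst c * rename s M dvd rename s P * (\<Prod>k\<in>W. lin k i)"
    using restricted_Q_dvd c by (simp add: pconst_mult_dvd_iff M_def)
  moreover have "(\<Prod>k\<in>W. lin k i) = (\<Prod>k\<in>W - K. lin k i) * (\<Prod>k\<in>K. lin k i :: ('n, 'k) mpoly)"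
    using assms(1) by (simp add: prod.subset_diff)
  ultimately have "rename s (\<eta> $ i) * (\<Prod>k\<in>K. lin k i)
      dvd (rename s P * (\<Prod>k\<in>W - K. lin k i)) * (\<Prod>k\<in>K. lin k i)"
    by (simp add: mult.assoc)
  moreover have "(\<Prod>k\<in>K. lin k i) \<noteq> (0 :: ('n, 'k) mpoly)" using K by simp
  ultimately have "rename s (\<eta> $ i) dvd rename s P * (\<Prod>k\<in>W - K. lin k i)" by simp
  \<comment> \<open>Divisibility suffices: the cofactor t is absorbed by passing to the logarithmic
    form t \<eta>.\<close>
  then obtain t where t: "rename s P * (\<Prod>k\<in>W - K. lin k i) = rename s (\<eta> $ i) * t" ..
  have "rename s (P * (\<Prod>k\<in>W - K. lin k i)) = rename s P * (\<Prod>k\<in>W - K. lin k i)"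
    using fixed[of "W - K"] by simp
  then have "rename s (rename s (P * (\<Prod>k\<in>W - K. lin k i))) = rename s (rename s (\<eta> $ i) * t)"
    using t by simp
  then have "rename s (P * (\<Prod>k\<in>W - K. lin k i)) = rename s ((t *s \<eta>) $ i)"
    by (simp only: rename_mult rename_rename rename_s_idem vector_smult_component mult.commute)
  then show ?thesis
    using is_log_mult[OF \<eta>] unfolding residue_reps_def by blast
qed

section \<open>Comparison with the intersection of the ideals\<close>

lemma residue_reps_iff:
  "\<rho> \<in> residue_reps \<longleftrightarrow> (\<forall>u\<in>W. \<forall>v\<in>W. u \<noteq> v \<longrightarrow> {u, v} \<notin> E \<longrightarrow> rename (collapse {u, v, j} i) \<rho> = 0)"
proof
  assume "\<rho> \<in> residue_reps"
  then show "\<forall>u\<in>W. \<forall>v\<in>W. u \<noteq> v \<longrightarrow> {u, v} \<notin> E \<longrightarrow> rename (collapse {u, v, j} i) \<rho> = 0"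
    unfolding residue_reps_def using residue_rep_vanishes by blast
next
  assume vanish: "\<forall>u\<in>W. \<forall>v\<in>W. u \<noteq> v \<longrightarrow> {u, v} \<notin> E \<longrightarrow> rename (collapse {u, v, j} i) \<rho> = 0"
  \<comment> \<open>Eliminating x_j first leaves only the variables indexed by u and v to collapse,
    and membership in \<open>residue_reps\<close> depends only on this image.\<close>
  have "rename s \<rho> \<in> residue_reps"
  proof (rule clique_monomials_generate[where adj = "\<lambda>u v. {u, v} \<in> E" and i = i and W = W])
    show "symp (\<lambda>u v. {u, v} \<in> E)" by (auto intro!: sympI simp: insert_commute)
    show "i \<notin> W" using W_neq by blast
    fix u v assume "u \<in> W" "v \<in> W" "u \<noteq> v" "{u, v} \<notin> E"
    moreover have "collapse {u, v} i \<circ> s = collapse {u, v, j} i"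
      by (auto simp: collapse_def)
    ultimately show "rename (collapse {u, v} i) (rename s \<rho>) = 0"
      using vanish by simp
  qed (auto intro: residue_reps_add residue_reps_mult clique_residue_reps)
  then show "\<rho> \<in> residue_reps" by (simp add: residue_reps_def)
qed

text \<open>The factor 1/c between residues and \<open>residue_reps\<close> is removed by scaling
  logarithmic forms by 1/c or c.\<close>

lemma residue_ideal_eq: "residue_ideal A \<alpha> H \<beta> = quot_class (\<alpha> H) ` residue_reps"
proof -
  obtain c where c: "c \<noteq> 0" "\<alpha> H $ i = c"
    using \<alpha>_coeffs[OF edge] H by metis
  let ?\<omega> = "\<lambda>\<eta>. inverse (to_fract Q) *s fract_form \<eta>"
  show ?thesis
  proof (intro equalityI subsetI)
    fix r assume "r \<in> residue_ideal A \<alpha> H \<beta>"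
    then obtain \<eta> where \<eta>: "is_log \<eta>" and r: "r = residue A \<alpha> H \<beta> (?\<omega> \<eta>)"
      by (auto simp: residue_ideal_def log_forms_eq)
    have log: "is_log (pconst (inverse c) *s \<eta>)" by (rule is_log_mult[OF \<eta>])
    then obtain \<rho> where \<rho>: "rename s (P * \<rho>) = rename s ((pconst (inverse c) *s \<eta>) $ i)"
      by (rule residue_rep_exists)
    then have "r = quot_class (\<alpha> H) \<rho>"
      unfolding r by (intro residue_eq \<eta>) (simp add: c)
    then show "r \<in> quot_class (\<alpha> H) ` residue_reps"
      unfolding residue_reps_def using log \<rho> by blast
  next
    fix r assume "r \<in> quot_class (\<alpha> H) ` residue_reps"
    then obtain \<rho> \<eta> where \<eta>: "is_log \<eta>" and \<rho>: "rename s (P * \<rho>) = rename s (\<eta> $ i)"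
      and r: "r = quot_class (\<alpha> H) \<rho>"
      by (auto simp: residue_reps_def)
    have "pconst (inverse c) * (pconst c * \<eta> $ i) = (pconst c * pconst (inverse c)) * \<eta> $ i"
      by (simp only: ac_simps)
    then have "pconst (inverse c) * (pconst c *s \<eta>) $ i = \<eta> $ i"
      by (simp only: vector_smult_component pconst_inverse[OF c(1)] mult_1)
    then have "residue A \<alpha> H \<beta> (?\<omega> (pconst c *s \<eta>)) = r"
      unfolding r by (intro residue_eq is_log_mult \<eta>) (simp only: \<rho> c)
    then show "r \<in> residue_ideal A \<alpha> H \<beta>"
      unfolding residue_ideal_def log_forms_eq using is_log_mult[OF \<eta>] by blast
  qed
qed

text \<open>Replacing x_j, x_u and x_v by x_i one after the other changes the polynomial by a
  multiple of the corresponding linear form; the three differences telescope.\<close>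

lemma quot_class_in_prime_iff:
  assumes "u \<in> W" "v \<in> W"
  shows "quot_class (\<alpha> H) \<rho> \<in> Idl\<^bsub>quot_ring (\<alpha> H)\<^esub>
      {quot_class (\<alpha> H) (pvar u - pvar i), quot_class (\<alpha> H) (pvar v - pvar i)}
    \<longleftrightarrow> rename (collapse {u, v, j} i) \<rho> = 0"
proof -
  obtain c where c: "c \<noteq> 0" "form_poly (\<alpha> H) = pconst c * lin i j"
    using form_\<alpha>[OF edge] H by metis
  have "(\<exists>a b d. \<rho> = form_poly (\<alpha> H) * d + lin u i * a + lin v i * b)
      \<longleftrightarrow> rename (collapse {u, v, j} i) \<rho> = 0"
  proof
    assume "\<exists>a b d. \<rho> = form_poly (\<alpha> H) * d + lin u i * a + lin v i * b"
    then obtain a b d where "\<rho> = form_poly (\<alpha> H) * d + lin u i * a + lin v i * b" by blast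
    moreover have "collapse {u, v, j} i k = i" if "k \<in> {u, v, i, j}" for k
      using that by (auto simp: collapse_def)
    ultimately show "rename (collapse {u, v, j} i) \<rho> = 0" by (simp add: c)
  next
    assume 0: "rename (collapse {u, v, j} i) \<rho> = 0"
    have "form_poly (\<alpha> H) dvd lin j i"
      using c by (simp add: pconst_mult_dvd_iff lin_swap[of j i])
    then have "form_poly (\<alpha> H) dvd \<rho> - rename s \<rho>"
      using lin_dvd_diff dvd_trans by blast
    then obtain d where d: "\<rho> - rename s \<rho> = form_poly (\<alpha> H) * d" ..
    obtain a where a: "rename s \<rho> - rename (collapse {u} i) (rename s \<rho>) = lin u i * a"
      using lin_dvd_diff[of u i "rename s \<rho>"] by (rule dvdE)
    obtain b where b: "rename (collapse {u} i) (rename s \<rho>)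
        - rename (collapse {v} i) (rename (collapse {u} i) (rename s \<rho>)) = lin v i * b"
      using lin_dvd_diff[of v i "rename (collapse {u} i) (rename s \<rho>)"] by (rule dvdE)
    have "collapse {v} i \<circ> (collapse {u} i \<circ> s) = collapse {u, v, j} i"
      by (auto simp: collapse_def)
    then have "rename (collapse {v} i) (rename (collapse {u} i) (rename s \<rho>)) = 0"
      using 0 by simp
    then have "\<rho> = form_poly (\<alpha> H) * d + lin u i * a + lin v i * b"
      by (simp only: a[symmetric] b[symmetric] d[symmetric]) simp
    then show "\<exists>a b d. \<rho> = form_poly (\<alpha> H) * d + lin u i * a + lin v i * b" by blast
  qed
  then show ?thesis by (simp add: quot_class_in_genideal_iff flip: lin_def)
qed

end

text \<open>Intersecting with the carrier makes the empty intersection the whole quotient ring, as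
  required when W is a clique. Ordered pairs list each two-element subset twice.\<close>

theorem theorem1p3:
  fixes E :: "'n::{finite,linorder} set set"
    and i j :: 'n
    and A :: "('n, 'k::field) space set set"
    and H :: "('n, 'k) space set"
    and W :: "'n set"
    and y :: "'n \<Rightarrow> ('n, 'k) mpoly set"
    and \<alpha> \<beta> :: "('n, 'k) space set \<Rightarrow> ('n, 'k) space"
  assumes "simple_graph E"
    and "{i, j} \<in> E"
    and "A = graphic_arrangement E"
    and "H = coord_hyperplane i j"
    and "\<And>L. L \<in> A \<Longrightarrow> defining_form UNIV L (\<alpha> L)"
    and "\<And>Y. Y \<in> restriction A H \<Longrightarrow> defining_form H Y (\<beta> Y)"
    and "W = {k. {k, i} \<in> E \<and> {k, j} \<in> E}"
    and "\<And>k. y k = quot_class (\<alpha> H) (pvar k - pvar i)"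
  shows "residue_ideal A \<alpha> H \<beta> =
    carrier (quot_ring (\<alpha> H)) \<inter>
    (\<Inter>(u, v) \<in> {(u, v). u \<in> W \<and> v \<in> W \<and> u \<noteq> v \<and> {u, v} \<notin> E}.
       Idl\<^bsub>quot_ring (\<alpha> H)\<^esub> {y u, y v})"
proof -
  interpret graphic_hyperplane E i j A H W \<alpha> \<beta>
    using assms(1-7) by unfold_locales
  have "quot_class (\<alpha> H) \<rho> \<in> residue_ideal A \<alpha> H \<beta> \<longleftrightarrow>
    (\<forall>u\<in>W. \<forall>v\<in>W. u \<noteq> v \<longrightarrow> {u, v} \<notin> E \<longrightarrow>
      quot_class (\<alpha> H) \<rho> \<in> Idl\<^bsub>quot_ring (\<alpha> H)\<^esub> {y u, y v})" for \<rho>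
  proof -
    have "quot_class (\<alpha> H) \<rho> \<in> residue_ideal A \<alpha> H \<beta> \<longleftrightarrow> \<rho> \<in> residue_reps"
    proof
      assume "quot_class (\<alpha> H) \<rho> \<in> residue_ideal A \<alpha> H \<beta>"
      then obtain \<rho>' where "\<rho>' \<in> residue_reps" "rename s \<rho> = rename s \<rho>'"
        by (auto simp: residue_ideal_eq quot_class_H_eq_iff)
      \<comment> \<open>Membership in \<open>residue_reps\<close> is independent of the
        representative of a class.\<close>
      then show "\<rho> \<in> residue_reps" by (simp add: residue_reps_def)
    qed (simp add: residue_ideal_eq)
    then show ?thesis
      unfolding residue_reps_iff assms(8) by (simp add: quot_class_in_prime_iff)
  qed
  note key = this
  show ?thesis
  proof (intro equalityI subsetI)
    fix r assume r: "r \<in> residue_ideal A \<alpha> H \<beta>"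
    then obtain \<rho> where "r = quot_class (\<alpha> H) \<rho>" by (auto simp: residue_ideal_eq)
    then show "r \<in> carrier (quot_ring (\<alpha> H)) \<inter>
      (\<Inter>(u, v) \<in> {(u, v). u \<in> W \<and> v \<in> W \<and> u \<noteq> v \<and> {u, v} \<notin> E}.
         Idl\<^bsub>quot_ring (\<alpha> H)\<^esub> {y u, y v})"
      using r key by (auto simp: carrier_quot_ring)
  next
    fix r assume r: "r \<in> carrier (quot_ring (\<alpha> H)) \<inter>
      (\<Inter>(u, v) \<in> {(u, v). u \<in> W \<and> v \<in> W \<and> u \<noteq> v \<and> {u, v} \<notin> E}.
         Idl\<^bsub>quot_ring (\<alpha> H)\<^esub> {y u, y v})"
    then obtain \<rho> where "r = quot_class (\<alpha> H) \<rho>" by (auto simp: carrier_quot_ring)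
    then show "r \<in> residue_ideal A \<alpha> H \<beta>"
      using r key by auto
  qed
qed

end
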